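(* Let $p,n\ge 1$, $d_1\ge\cdots\ge d_p>0$, $D=\mathrm{diag}(d_1,\dots,d_p)$, $C=\mathrm{diag}(c_1,\dots,c_p)$ with $c_i\ge 1$ for all $i$, and $j\in\mathbb{R}$. Suppose $(X',Z')'\in\mathbb{R}^p\times\mathbb{R}^n$ has density $\prod_i d_i^{-1/2}\,\sigma^{-p-n} f(\{(x-\theta)'D^{-1}(x-\theta)+z'z\}/\sigma^2)$ with $\theta\in\mathbb{R}^p$ and $\sigma>0$ unknown. Let $S=Z'Z$, $W=X'C^{-1}D^{-1}X/S$ and, for a differentiable function $\phi:(0,\infty)\to\mathbb{R}$, let $$\hat\theta_\phi=\left(I-\frac{\phi(W)}{W}C^{-1}\right)X .$$ If $\phi'(w)\ge 0$ and $$0\le \phi(w)\le \frac{2}{n+2}\left(\frac{\sum_{i=1}^p d_i^{1-j}/c_i}{\max_{1\le i\le p} d_i^{1-j}/c_i}-2\right)$$ for all $w>0$, then $\hat\theta_\phi$ is a minimax estimator of $\theta$ under the loss $L_j(\delta,\theta,\sigma^2)=(\delta-\theta)'D^{-j}(\delta-\theta)/\sigma^2$.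
   Context: Here $f:[0,\infty)\to[0,\infty)$ is a fixed function such that the displayed expression is a probability density and $X$ has finite second moments. The risk is $R_j(\delta,\theta,\sigma^2)=E[L_j(\delta(X,Z),\theta,\sigma^2)]$. The estimator $X$ (the least squares estimator in canonical form) is minimax with constant risk, so an estimator $\delta$ is minimax if and only if $R_j(\delta,\theta,\sigma^2)\le R_j(X,\theta,\sigma^2)$ for all $\theta\in\mathbb{R}^p$ and $\sigma>0$. $D^{-j}=\mathrm{diag}(d_1^{-j},\dots,d_p^{-j})$. *)

theory Defs
  imports "HOL-Probability.Probability"
begin

type_synonym ('p, 'n) sample = "(real, 'p) vec \<times> (real, 'n) vec"

definition diag_matrix :: "real ^ 'p \<Rightarrow> real ^ 'p ^ 'p" where
  "diag_matrix v = (\<chi> i k. if i = k then v $ i else 0)"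

definition sample_density ::
    "(real \<Rightarrow> real) \<Rightarrow> real ^ 'p \<Rightarrow> real ^ 'p \<Rightarrow> real \<Rightarrow> ('p, 'n::finite) sample \<Rightarrow> real" where
  "sample_density f d \<theta> \<sigma> = (\<lambda>(x, z).
     (\<Prod>i\<in>UNIV. d $ i powr (- 1 / 2)) * \<sigma> powi (- int CARD('p) - int CARD('n)) *
     f (((x - \<theta>) \<bullet> (matrix_inv (diag_matrix d) *v (x - \<theta>)) + z \<bullet> z) / \<sigma>\<^sup>2))"

definition sample_dist ::
    "(real \<Rightarrow> real) \<Rightarrow> real ^ 'p \<Rightarrow> real ^ 'p \<Rightarrow> real \<Rightarrow> ('p, 'n::finite) sample measure" where
  "sample_dist f d \<theta> \<sigma> = density lborel (\<lambda>xz. ennreal (sample_density f d \<theta> \<sigma> xz))"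

text \<open>The matrix \<open>D\<^sup>-\<^sup>j\<close>, with a real exponent \<open>j\<close>, is \<open>diag (d\<^sub>i powr - j)\<close>.
  The last argument is the variance parameter \<open>\<sigma>\<^sup>2\<close>, not \<open>\<sigma>\<close>.\<close>

definition loss :: "real \<Rightarrow> real ^ 'p \<Rightarrow> real ^ 'p \<Rightarrow> real ^ 'p \<Rightarrow> real \<Rightarrow> real" where
  "loss j d a \<theta> s2 = (a - \<theta>) \<bullet> (diag_matrix (\<chi> i. d $ i powr (- j)) *v (a - \<theta>)) / s2"

text \<open>The loss is nonnegative, so its expectation is taken in \<open>[0, \<infinity>]\<close>; an estimator with
  a non-integrable loss has infinite risk.\<close>

definition risk ::
    "(real \<Rightarrow> real) \<Rightarrow> real ^ 'p \<Rightarrow> real \<Rightarrow> (('p, 'n::finite) sample \<Rightarrow> real ^ 'p) \<Rightarrow>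
     real ^ 'p \<Rightarrow> real \<Rightarrow> ennreal" where
  "risk f d j \<delta> \<theta> \<sigma> =
     (\<integral>\<^sup>+ xz. ennreal (loss j d (\<delta> xz) \<theta> (\<sigma>\<^sup>2)) \<partial>sample_dist f d \<theta> \<sigma>)"

definition max_risk ::
    "(real \<Rightarrow> real) \<Rightarrow> real ^ 'p \<Rightarrow> real \<Rightarrow> (('p, 'n::finite) sample \<Rightarrow> real ^ 'p) \<Rightarrow> ennreal" where
  "max_risk f d j \<delta> = (SUP (\<theta>, \<sigma>) \<in> UNIV \<times> {0<..}. risk f d j \<delta> \<theta> \<sigma>)"

text \<open>Estimators are the Borel functions of the sample; minimaxity is with respect to all of
  them. No randomisation is needed, since the loss is convex in the action.\<close>

definition minimax ::
    "(real \<Rightarrow> real) \<Rightarrow> real ^ 'p \<Rightarrow> real \<Rightarrow> (('p, 'n::finite) sample \<Rightarrow> real ^ 'p) \<Rightarrow> bool" where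
  "minimax f d j \<delta> \<longleftrightarrow>
     \<delta> \<in> borel_measurable borel \<and>
     (\<forall>\<delta>' :: ('p, 'n::finite) sample \<Rightarrow> real ^ 'p. \<delta>' \<in> borel_measurable borel \<longrightarrow>
        max_risk f d j \<delta> \<le> max_risk f d j \<delta>')"

definition W_stat :: "real ^ 'p \<Rightarrow> real ^ 'p \<Rightarrow> ('p, 'n::finite) sample \<Rightarrow> real" where
  "W_stat c d = (\<lambda>(x, z).
     x \<bullet> ((matrix_inv (diag_matrix c) ** matrix_inv (diag_matrix d)) *v x) / (z \<bullet> z))"

text \<open>On the null set where \<open>x = 0\<close> or \<open>z = 0\<close>, division by zero gives \<open>W = 0\<close> and hence the
  value \<open>x\<close>; only the values of \<open>\<phi>\<close> on \<open>(0, \<infinity>)\<close> matter.\<close>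

definition shrinkage_estimator ::
    "real ^ 'p \<Rightarrow> real ^ 'p \<Rightarrow> (real \<Rightarrow> real) \<Rightarrow> ('p, 'n::finite) sample \<Rightarrow> real ^ 'p" where
  "shrinkage_estimator c d \<phi> = (\<lambda>(x, z).
     (mat 1 - (\<phi> (W_stat c d (x, z)) / W_stat c d (x, z)) *\<^sub>R matrix_inv (diag_matrix c)) *v x)"

end

theory Submission
  imports Defs
begin

text \<open>
  Write \<open>g\<close> for the radial density and put \<open>G t = (1/2) \<integral>\<^sub>t\<^sup>\<infinity> g\<close>. Since \<open>- d\<^sub>i \<partial>\<^sub>i (G \<circ> quad) = (x\<^sub>i - \<theta>\<^sub>i) (g \<circ> quad)\<close>,
  integration by parts turns the cross terms of the risk into integrals against the measure with
  density \<open>G \<circ> quad\<close>, the same one for all coordinates of \<open>x\<close> and \<open>z\<close>. There the integrand of the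
  risk difference is pointwise nonpositive by the bound on \<open>\<phi>\<close>; the terms with \<open>\<phi>'\<close> have a
  favourable sign and are dropped, which makes the identity an inequality and spares any
  integrability of \<open>\<phi>'\<close>. Replacing \<open>\<phi> w\<close> by \<open>\<phi> w * w / (w + \<epsilon>)\<close> keeps the hypotheses and bounds
  \<open>\<phi> w / w\<close>, so that all integrals exist; Fatou's lemma lets \<open>\<epsilon>\<close> tend to 0.
  That \<open>X\<close> itself is minimax follows, for each fixed \<open>\<sigma>\<close>, from uniform priors for \<open>\<theta>\<close> on large cubes.
\<close>

section \<open>Symmetries of Lebesgue measure\<close>

text \<open>The density is only Borel measurable, so G has no pointwise derivative with which to
  integrate by parts. Tonelli's theorem on chords replaces it. Reflecting coordinate b about its
  mean preserves the distribution, so the integral of (y_b - \<mu>_b) h(y) folds onto a half space,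
  and only the increment of h from the mirror image of y to y remains. Integrating k over these
  chords against the radial density gives l_b times the integral of k against the measure of G. It
  is thus enough to bound increments of h along lines by integrals of k. The constant: let T be the
  sum of the d_i^(1-j)/c_i, \<alpha> their maximum and A their average with weights proportional to
  x_i^2/(c_i d_i). Under the new measure the cross terms contribute -2 (\<phi>/w) (T - 2A). The
  quadratic term contributes at most (n + 2) A (\<phi>/w) K, where K bounds \<phi>: n from the
  coordinates of z, and 2 from differentiating \<phi>^2/w. Since A \<le> \<alpha>, the sum is
  nonpositive once (n + 2) K \<le> 2 (T/\<alpha> - 2).\<close>

lemma nn_integral_lborel_translate:
  fixes F :: "'a::euclidean_space \<Rightarrow> ennreal"
  assumes [measurable]: "F \<in> borel_measurable borel"
  shows "(\<integral>\<^sup>+x. F (x + c) \<partial>lborel) = (\<integral>\<^sup>+x. F x \<partial>lborel)"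
proof -
  have "(\<integral>\<^sup>+x. F x \<partial>lborel) = (\<integral>\<^sup>+x. F x \<partial>distr lborel borel ((+) c))"
    by (simp add: lborel_distr_plus)
  also have "\<dots> = (\<integral>\<^sup>+x. F (c + x) \<partial>lborel)"
    by (subst nn_integral_distr) simp_all
  finally show ?thesis by (simp add: add.commute)
qed

text \<open>The reflection in the hyperplane through \<open>t\<close> orthogonal to \<open>b\<close>
  is a diagonal affine map with entries 1 and -1, so its Jacobian has absolute value 1.\<close>

lemma lborel_distr_reflection:
  fixes b t :: "'a::euclidean_space"
  assumes b: "b \<in> Basis"
  shows "distr lborel borel (\<lambda>y. y - (2 * ((y - t) \<bullet> b)) *\<^sub>R b) = lborel"
proof -
  define c where "c j = (if j = b then -1 else 1 :: real)" for j
  have eq: "(\<lambda>y. y - (2 * ((y - t) \<bullet> b)) *\<^sub>R b) =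
      (\<lambda>x. (2 * (t \<bullet> b)) *\<^sub>R b + (\<Sum>j\<in>Basis. (c j * (x \<bullet> j)) *\<^sub>R j))"
  proof
    fix y :: 'a
    have "(\<Sum>j\<in>Basis. (c j * (y \<bullet> j)) *\<^sub>R j)
        = (\<Sum>j\<in>Basis. (y \<bullet> j) *\<^sub>R j - (if j = b then (2 * (y \<bullet> b)) *\<^sub>R b else 0))"
      by (rule sum.cong) (auto simp: c_def simp flip: scaleR_left_diff_distrib)
    also have "\<dots> = y - (2 * (y \<bullet> b)) *\<^sub>R b"
      using b by (simp add: sum_subtractf euclidean_representation)
    finally show "y - (2 * ((y - t) \<bullet> b)) *\<^sub>R b =
        (2 * (t \<bullet> b)) *\<^sub>R b + (\<Sum>j\<in>Basis. (c j * (y \<bullet> j)) *\<^sub>R j)"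
      by (simp add: inner_diff_left algebra_simps)
  qed
  have "(\<Prod>j\<in>Basis. \<bar>c j\<bar>) = 1"
    by (rule prod.neutral) (simp add: c_def)
  with lborel_affine_euclidean[of c "(2 * (t \<bullet> b)) *\<^sub>R b"] show ?thesis
    unfolding eq by (simp add: c_def density_1 split: if_splits)
qed

lemma nn_integral_lborel_reflect:
  fixes F :: "'a::euclidean_space \<Rightarrow> ennreal"
  assumes [measurable]: "F \<in> borel_measurable borel"
  shows "(\<integral>\<^sup>+x. F (t - x) \<partial>lborel) = (\<integral>\<^sup>+x. F x \<partial>lborel)"
proof -
  have "(\<integral>\<^sup>+x. F x \<partial>lborel) = (\<integral>\<^sup>+x. F x \<partial>density (distr lborel borel (\<lambda>x. t + (-1) *\<^sub>R x)) (\<lambda>_. ennreal (\<bar>-1\<bar>^DIM('a))))"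
    by (subst lborel_affine[of "-1" t]) simp_all
  also have "\<dots> = (\<integral>\<^sup>+x. F (t - x) \<partial>lborel)"
    by (simp add: density_1 nn_integral_distr)
  finally show ?thesis by simp
qed

lemma nn_integral_lborel_pair:
  fixes F :: "'a::euclidean_space \<times> 'b::euclidean_space \<Rightarrow> ennreal"
  assumes "F \<in> borel_measurable borel"
  shows "(\<integral>\<^sup>+w. F w \<partial>lborel) = (\<integral>\<^sup>+z. \<integral>\<^sup>+x. F (x, z) \<partial>lborel \<partial>lborel)"
  unfolding lborel_prod[symmetric]
  by (rule lborel_pair.nn_integral_snd[symmetric]) (use assms in \<open>simp add: lborel_prod\<close>)

section \<open>Minimaxity of the identity in location families\<close>

text \<open>Since \<open>q\<close> is even, replacing \<open>u\<close> by \<open>- u\<close> does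
  not change the right-hand side; averaging both forms brings in the midpoint inequality
  \<open>convex\<close>.\<close>

lemma location_symmetrised_loss_le:
  fixes q \<rho> :: "'a::euclidean_space \<Rightarrow> ennreal"
  assumes [measurable]: "q \<in> borel_measurable borel" "\<rho> \<in> borel_measurable borel"
    and even: "\<And>u. q (- u) = q u"
    and convex: "\<And>a u. 2 * \<rho> u \<le> \<rho> (u + a) + \<rho> (- u + a)"
  shows "(\<integral>\<^sup>+u. q u * \<rho> u \<partial>lborel) \<le> (\<integral>\<^sup>+u. q u * \<rho> (u + a) \<partial>lborel)"
proof -
  have "(\<integral>\<^sup>+u. q u * \<rho> (u + a) \<partial>lborel) = (\<integral>\<^sup>+u. q (0 - u) * \<rho> ((0 - u) + a) \<partial>lborel)"
    by (rule nn_integral_lborel_reflect[symmetric]) simp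
  then have refl: "(\<integral>\<^sup>+u. q u * \<rho> (u + a) \<partial>lborel) = (\<integral>\<^sup>+u. q u * \<rho> (- u + a) \<partial>lborel)"
    by (simp add: even)
  have "2 * (\<integral>\<^sup>+u. q u * \<rho> u \<partial>lborel) = (\<integral>\<^sup>+u. q u * (2 * \<rho> u) \<partial>lborel)"
    by (subst nn_integral_cmult[symmetric]) (simp_all add: ac_simps)
  also have "\<dots> \<le> (\<integral>\<^sup>+u. q u * \<rho> (u + a) + q u * \<rho> (- u + a) \<partial>lborel)"
    by (rule nn_integral_mono) (use convex in \<open>simp add: mult_left_mono flip: distrib_left\<close>)
  also have "\<dots> = 2 * (\<integral>\<^sup>+u. q u * \<rho> (u + a) \<partial>lborel)"
    by (subst nn_integral_add) (simp_all add: refl mult_2)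
  finally show ?thesis
    by (simp add: ennreal_mult_le_mult_iff)
qed

text \<open>A supremum of risks dominates any average of them. Averaging over \<theta> in a large
  cube and substituting u = x - \<theta> turns the decision at a fixed sample into a shift of u by
  the constant \<delta>(x, z) - x, and the symmetrised inequality shows that a zero shift is best.
  Only boundary effects of the cube are lost, and these vanish in the limit.\<close>

lemma location_risk_lower_bound:
  fixes p :: "'a::euclidean_space \<times> 'b::euclidean_space \<Rightarrow> ennreal"
    and \<rho> :: "'a \<Rightarrow> ennreal" and \<delta> :: "'a \<times> 'b \<Rightarrow> 'a"
  assumes [measurable]: "p \<in> borel_measurable borel" "\<rho> \<in> borel_measurable borel"
      "\<delta> \<in> borel_measurable borel"
    and even: "\<And>u z. p (- u, z) = p (u, z)"
    and convex: "\<And>a u. 2 * \<rho> u \<le> \<rho> (u + a) + \<rho> (- u + a)"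
    and risk: "\<And>\<theta>. (\<integral>\<^sup>+w. p (fst w - \<theta>, snd w) * \<rho> (\<delta> w - \<theta>) \<partial>lborel) \<le> M"
  shows "(\<integral>\<^sup>+w. p w * \<rho> (fst w) \<partial>lborel) \<le> M"
proof (cases "M = \<infinity>")
  case False
  define B where "B r = cbox (- (r *\<^sub>R One)) (r *\<^sub>R One :: 'a)" for r :: real
  have B: "u \<in> B r \<longleftrightarrow> (\<forall>i\<in>Basis. - r \<le> u \<bullet> i \<and> u \<bullet> i \<le> r)" for u r
    by (simp add: B_def mem_box)
  have B_diff: "x - u \<in> B (k + r)" if "x \<in> B k" "u \<in> B r" for x u k r
    unfolding B
  proof
    fix i :: 'a assume "i \<in> Basis"
    with that have "- k \<le> x \<bullet> i" "x \<bullet> i \<le> k" "- r \<le> u \<bullet> i" "u \<bullet> i \<le> r"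
      by (auto simp: B)
    then show "- (k + r) \<le> (x - u) \<bullet> i \<and> (x - u) \<bullet> i \<le> k + r"
      by (simp add: inner_diff_left)
  qed
  have [measurable]: "B r \<in> sets borel" for r by (simp add: B_def)
  have emB: "emeasure lborel (B r) = ennreal ((2 * r) ^ DIM('a))" if "r \<ge> 0" for r
    using that unfolding B_def by (subst emeasure_lborel_cbox) (auto simp: algebra_simps)
  define I where "I r = (\<integral>\<^sup>+w. p w * \<rho> (fst w) * indicator (B r) (fst w) \<partial>lborel)" for r
  note [measurable (raw)] =
    measurable_compose[OF borel_measurable_Pair \<open>p \<in> borel_measurable borel\<close>]
    measurable_compose[OF borel_measurable_Pair \<open>\<delta> \<in> borel_measurable borel\<close>]
  have [measurable]: "(fst :: 'a \<times> 'b \<Rightarrow> 'a) \<in> borel_measurable borel"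
    "(snd :: 'a \<times> 'b \<Rightarrow> 'b) \<in> borel_measurable borel"
    by (intro borel_measurable_continuous_onI continuous_intros)+
  \<comment> \<open>The left side is a lower bound for the unnormalised average over a prior cube of
    half-width \<open>k + r\<close>, in which only samples with x in \<open>B k\<close> and errors u
    in \<open>B r\<close> are kept.\<close>
  have key: "emeasure lborel (B k) * I r \<le> M * emeasure lborel (B (k + r))" if "k \<ge> 0" "r \<ge> 0" for k r
  proof -
    define F where "F \<theta> w = p (fst w - \<theta>, snd w) * \<rho> (\<delta> w - \<theta>) * indicator (B (k + r)) \<theta>"
      for \<theta> and w :: "'a \<times> 'b"
    define J where "J z = (\<integral>\<^sup>+u. (p (u, z) * indicator (B r) u) * \<rho> u \<partial>lborel)" for z
    have [measurable]: "J \<in> borel_measurable borel"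
      unfolding J_def by measurable
    have inner: "indicator (B k) x * J z \<le> (\<integral>\<^sup>+\<theta>. F \<theta> (x, z) \<partial>lborel)" for x z
    proof (cases "x \<in> B k")
      case True
      \<comment> \<open>Here \<open>u = x - \<theta>\<close>; the prior cube is enlarged by \<open>r\<close> so that all \<open>u \<in> B r\<close> stay available.\<close>
      have "J z \<le> (\<integral>\<^sup>+u. (p (u, z) * indicator (B r) u) * \<rho> (u + (\<delta> (x, z) - x)) \<partial>lborel)"
        unfolding J_def
      proof (rule location_symmetrised_loss_le)
        show "p (- u, z) * indicator (B r) (- u) = p (u, z) * indicator (B r) u" for u
          using even by (auto simp: B indicator_def minus_le_iff)
      qed (use convex in simp_all)
      also have "\<dots> \<le> (\<integral>\<^sup>+u. F (x - u) (x, z) \<partial>lborel)"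
        by (rule nn_integral_mono)
          (use True B_diff in \<open>auto simp: F_def indicator_def algebra_simps\<close>)
      also have "\<dots> = (\<integral>\<^sup>+\<theta>. F \<theta> (x, z) \<partial>lborel)"
        by (rule nn_integral_lborel_reflect) (simp add: F_def)
      finally show ?thesis using True by simp
    qed simp
    have "emeasure lborel (B k) * I r = emeasure lborel (B k) * (\<integral>\<^sup>+z. J z \<partial>lborel)"
      unfolding I_def J_def
      by (subst nn_integral_lborel_pair[of "\<lambda>w. p w * \<rho> (fst w) * indicator (B r) (fst w)"])
        (simp_all add: ac_simps)
    also have "\<dots> = (\<integral>\<^sup>+z. \<integral>\<^sup>+x. indicator (B k) x * J z \<partial>lborel \<partial>lborel)"
      by (simp add: nn_integral_multc nn_integral_cmult)
    also have "\<dots> \<le> (\<integral>\<^sup>+z. \<integral>\<^sup>+x. \<integral>\<^sup>+\<theta>. F \<theta> (x, z) \<partial>lborel \<partial>lborel \<partial>lborel)"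
      by (intro nn_integral_mono inner)
    also have "\<dots> = (\<integral>\<^sup>+w. \<integral>\<^sup>+\<theta>. F \<theta> w \<partial>lborel \<partial>lborel)"
      by (rule nn_integral_lborel_pair[of "\<lambda>w. \<integral>\<^sup>+\<theta>. F \<theta> w \<partial>lborel", symmetric])
        (simp add: F_def)
    also have "\<dots> = (\<integral>\<^sup>+\<theta>. \<integral>\<^sup>+w. F \<theta> w \<partial>lborel \<partial>lborel)"
      unfolding F_def by (rule lborel_pair.Fubini') simp
    also have "\<dots> \<le> (\<integral>\<^sup>+\<theta>. M * indicator (B (k + r)) \<theta> \<partial>lborel)"
    proof (rule nn_integral_mono)
      fix \<theta>
      have "(\<integral>\<^sup>+w. F \<theta> w \<partial>lborel)
          = (\<integral>\<^sup>+w. p (fst w - \<theta>, snd w) * \<rho> (\<delta> w - \<theta>) \<partial>lborel) * indicator (B (k + r)) \<theta>"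
        unfolding F_def by (rule nn_integral_multc) simp
      also have "\<dots> \<le> M * indicator (B (k + r)) \<theta>"
        by (rule mult_right_mono[OF risk]) simp
      finally show "(\<integral>\<^sup>+w. F \<theta> w \<partial>lborel) \<le> M * indicator (B (k + r)) \<theta>" .
    qed
    also have "\<dots> = M * emeasure lborel (B (k + r))"
      by (simp add: nn_integral_cmult)
    finally show ?thesis .
  qed
  \<comment> \<open>Divide \<open>key\<close> by the volume of \<open>B k\<close> and let
    \<open>k\<close> grow with \<open>r\<close> fixed: the ratio of the two volumes tends to 1. The
    limit \<open>r\<close> to infinity is taken afterwards, by monotone convergence.\<close>
  have I_le: "I (real r) \<le> M" for r :: nat
  proof (rule LIMSEQ_le_const)
    have "(\<lambda>k. ((real k + real r) / real k) ^ DIM('a)) \<longlonglongrightarrow> 1 ^ DIM('a)"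
      by (rule tendsto_power) real_asymp
    then have "(\<lambda>k. ennreal (((real k + real r) / real k) ^ DIM('a))) \<longlonglongrightarrow> ennreal 1"
      by (intro tendsto_ennrealI) simp
    from ennreal_tendsto_cmult[OF _ this, of M]
    show "(\<lambda>k. M * ennreal (((real k + real r) / real k) ^ DIM('a))) \<longlonglongrightarrow> M"
      using False by (simp add: less_top)
    have "I (real r) \<le> M * ennreal (((real k + real r) / real k) ^ DIM('a))" if "k \<ge> 1" for k :: nat
    proof -
      have "ennreal ((2 * real k) ^ DIM('a)) * I (real r)
          \<le> M * ennreal ((2 * (real k + real r)) ^ DIM('a))"
        using key[of "real k" "real r"] emB[of "real k"] emB[of "real k + real r"] by simp
      also have "(2 * (real k + real r)) ^ DIM('a)
          = (2 * real k) ^ DIM('a) * ((real k + real r) / real k) ^ DIM('a)"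
        using that by (subst power_mult_distrib[symmetric]) simp
      finally have "ennreal ((2 * real k) ^ DIM('a)) * I (real r) \<le> ennreal ((2 * real k) ^ DIM('a)) *
          (M * ennreal (((real k + real r) / real k) ^ DIM('a)))"
        by (simp add: ennreal_mult ac_simps)
      then show ?thesis
        using that by (subst (asm) ennreal_mult_le_mult_iff) auto
    qed
    then show "\<exists>N. \<forall>k\<ge>N. I (real r) \<le> M * ennreal (((real k + real r) / real k) ^ DIM('a))"
      by blast
  qed
  have "(\<integral>\<^sup>+w. p w * \<rho> (fst w) \<partial>lborel)
      = (\<integral>\<^sup>+w. (SUP r. p w * \<rho> (fst w) * indicator (B (real r)) (fst w)) \<partial>lborel)"
  proof (rule nn_integral_cong)
    fix w :: "'a \<times> 'b"
    obtain r :: nat where "norm (fst w) \<le> real r"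
      using real_arch_simple by blast
    then have "fst w \<in> B (real r)"
      using Basis_le_norm[of _ "fst w"] by (fastforce simp: B abs_le_iff)
    then have "p w * \<rho> (fst w) \<le> (SUP r. p w * \<rho> (fst w) * indicator (B (real r)) (fst w))"
      by (intro SUP_upper2[of r]) auto
    moreover have "(SUP r. p w * \<rho> (fst w) * indicator (B (real r)) (fst w)) \<le> p w * \<rho> (fst w)"
      by (rule SUP_least) (simp add: indicator_def)
    ultimately show "p w * \<rho> (fst w) = (SUP r. p w * \<rho> (fst w) * indicator (B (real r)) (fst w))"
      by (rule antisym)
  qed
  also have "\<dots> = (SUP r. I (real r))"
    unfolding I_def
  proof (rule nn_integral_monotone_convergence_SUP)
    show "incseq (\<lambda>r w. p w * \<rho> (fst w) * indicator (B (real r)) (fst w))"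
      by (rule incseq_SucI, rule le_funI) (fastforce simp: indicator_def B)
    show "(\<lambda>w. p w * \<rho> (fst w) * indicator (B (real r)) (fst w)) \<in> borel_measurable lborel" for r
      by measurable
  qed
  also have "\<dots> \<le> M"
    by (rule SUP_least) (rule I_le)
  finally show ?thesis .
qed simp

section \<open>Stein's inequality for elliptical distributions\<close>

text \<open>The coordinates of x and z live in one Euclidean space, with \<open>l\<close> the
  squared scale in each basis direction. One Stein inequality then serves both the numerator of W,
  with scale d_i, and its denominator, with scale 1.\<close>

locale elliptical =
  fixes g :: "real \<Rightarrow> ennreal" and \<mu> :: "'a::euclidean_space" and l :: "'a \<Rightarrow> real"
  assumes g_measurable [measurable]: "g \<in> borel_measurable borel"
    and g_finite: "\<And>t. g t < \<infinity>"
    and l_pos: "\<And>b. b \<in> Basis \<Longrightarrow> l b > 0"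
begin

section \<open>The elliptical measure \<open>P\<close> and its companion \<open>N\<close>\<close>

definition coord :: "'a \<Rightarrow> 'a \<Rightarrow> real" where
  "coord b y = (y - \<mu>) \<bullet> b"

definition quad :: "'a \<Rightarrow> real" where
  "quad y = (\<Sum>b\<in>Basis. (coord b y)\<^sup>2 / l b)"

definition P :: "'a measure" where
  "P = density lborel (\<lambda>y. g (quad y))"

text \<open>The factor 1/2 cancels the 2 in the derivative 2 (y_b - \<mu>_b) / l_b of
  \<open>quad\<close>. Extended real values allow the tail to be infinite at points such as the
  centre.\<close>

definition tail :: "real \<Rightarrow> ennreal" where
  "tail t = (\<integral>\<^sup>+u. (if t \<le> u then g u else 0) \<partial>lborel) / 2"

definition N :: "'a measure" where
  "N = density lborel (\<lambda>y. tail (quad y))"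

lemma coord_measurable [measurable]: "coord b \<in> borel_measurable borel"
  unfolding coord_def[abs_def] by measurable

lemma quad_measurable [measurable]: "quad \<in> borel_measurable borel"
  unfolding quad_def[abs_def] by measurable

lemma tail_measurable [measurable]: "tail \<in> borel_measurable borel"
  unfolding tail_def[abs_def] by measurable

lemma sets_P [simp, measurable_cong]: "sets P = sets borel"
  and sets_N [simp, measurable_cong]: "sets N = sets borel"
  and space_P [simp]: "space P = UNIV" and space_N [simp]: "space N = UNIV"
  by (simp_all add: P_def N_def)

lemma AE_P: "AE y in lborel. Q y \<Longrightarrow> AE y in P. Q y"
  unfolding P_def by (auto simp: AE_density elim: eventually_mono)

section \<open>Coordinate lines and reflections\<close>

lemma quad_line:
  assumes "b \<in> Basis"
  shows "quad (y + s *\<^sub>R b) = quad y + (2 * s * coord b y + s\<^sup>2) / l b"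
proof -
  have "quad (y + s *\<^sub>R b) = (\<Sum>c\<in>Basis. (coord c y)\<^sup>2 / l c +
      (if c = b then (2 * s * coord b y + s\<^sup>2) / l b else 0))"
    unfolding quad_def coord_def
    by (rule sum.cong)
      (use assms in \<open>auto simp: inner_add_left inner_diff_left inner_Basis power2_eq_square
        field_simps simp flip: add_divide_distrib\<close>)
  then show ?thesis
    using assms by (simp add: sum.distrib quad_def)
qed

definition reflection :: "'a \<Rightarrow> 'a \<Rightarrow> 'a" where
  "reflection b y = y - (2 * coord b y) *\<^sub>R b"

lemma reflection_measurable [measurable]: "reflection b \<in> borel_measurable borel"
  unfolding reflection_def[abs_def] by measurable

lemma coord_reflection:
  "b \<in> Basis \<Longrightarrow> coord b (reflection b y) = - coord b y"
  by (simp add: reflection_def coord_def inner_diff_left)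

lemma quad_reflection: "b \<in> Basis \<Longrightarrow> quad (reflection b y) = quad y"
  using quad_line[of b y "- (2 * coord b y)"]
  by (simp add: reflection_def power2_eq_square algebra_simps)

lemma distr_reflection:
  assumes "b \<in> Basis"
  shows "distr P borel (reflection b) = P"
proof -
  have "P = density (distr lborel borel (reflection b)) (\<lambda>y. g (quad y))"
    using lborel_distr_reflection[OF assms, of \<mu>] by (simp add: P_def reflection_def[abs_def] coord_def)
  also have "\<dots> = distr (density lborel (\<lambda>y. g (quad (reflection b y)))) borel (reflection b)"
    by (subst density_distr) simp_all
  also have "\<dots> = distr P borel (reflection b)"
    using assms by (simp add: quad_reflection P_def)
  finally show ?thesis by simp
qed

text \<open>Substitute u = \<open>quad (y + s *\<^sub>R b)\<close> along the ray on which this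
  function increases from the value \<open>quad y\<close>. Its derivative in s is twice the factor
  in the integrand, and the 2 cancels the 1/2 in \<open>tail\<close>. The same \<open>tail\<close>
  arises for every direction \<open>b\<close>, which is why a single measure \<open>N\<close>
  suffices.\<close>

lemma tail_eq_line_integral:
  assumes b: "b \<in> Basis"
  shows "tail (quad y) = (\<integral>\<^sup>+s. (if max 0 (- 2 * coord b y) \<le> s
    then g (quad (y + s *\<^sub>R b)) * ennreal ((coord b y + s) / l b) else 0) \<partial>lborel)"
proof -
  define T where "T s = quad y + (2 * s * coord b y + s\<^sup>2) / l b" for s
  have [measurable]: "T \<in> borel_measurable borel"
    unfolding T_def[abs_def] by measurable
  \<comment> \<open>If \<open>coord b y\<close> is negative, \<open>quad\<close> first decreases
    along the line and regains its value at the mirror image of \<open>y\<close>, reached at s =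
    \<open>- 2 * coord b y\<close>; from there on it increases.\<close>
  define s0 where "s0 = max 0 (- 2 * coord b y)"
  have l: "l b > 0" using b l_pos by blast
  have T: "quad (y + s *\<^sub>R b) = T s" for s
    using quad_line[OF b] by (simp add: T_def)
  have T0: "T s0 = quad y"
    by (auto simp: T_def s0_def max_def power2_eq_square)
  \<comment> \<open>This quadratic growth ensures that the compact ranges up to
    \<open>T (s0 + real n)\<close> exhaust the whole half-line above \<open>quad y\<close>.\<close>
  have Tge: "T (s0 + n) \<ge> quad y + n\<^sup>2 / l b" if "n \<ge> 0" for n :: real
  proof -
    have "2 * (s0 + n) * coord b y + (s0 + n)\<^sup>2 \<ge> n\<^sup>2"
    proof (cases "coord b y \<ge> 0")
      case True
      then show ?thesis using that by (simp add: s0_def max_def)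
    next
      case False
      then have "s0 = - 2 * coord b y" by (simp add: s0_def)
      then have "2 * (s0 + n) * coord b y + (s0 + n)\<^sup>2 = n\<^sup>2 + 2 * n * (- coord b y)"
        by (simp add: power2_eq_square algebra_simps)
      then show ?thesis using False that by (simp add: mult_nonneg_nonpos)
    qed
    then show ?thesis using l by (simp add: T_def divide_right_mono)
  qed
  \<comment> \<open>The substitution rule concerns real integrands on compact intervals. Hence the
    truncation at \<open>n\<close>, removed below by monotone convergence, and
    \<open>enn2real\<close>, which loses nothing because \<open>g\<close> is finite.\<close>
  have step: "(\<integral>\<^sup>+u. g u * indicator {quad y..T (s0 + real n)} u \<partial>lborel) =
      2 * (\<integral>\<^sup>+s. g (T s) * ennreal ((coord b y + s) / l b) * indicator {s0..s0 + real n} s \<partial>lborel)" for n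
  proof -
    have "(\<integral>\<^sup>+u. ennreal (enn2real (g u)) * indicator {T s0..T (s0 + real n)} u \<partial>lborel) =
      (\<integral>\<^sup>+s. ennreal (enn2real (g (T s)) * (2 * ((coord b y + s) / l b))) * indicator {s0..s0 + real n} s \<partial>lborel)"
    proof -
      have "(\<integral>\<^sup>+u. ennreal (enn2real (g u) * indicator {T s0..T (s0 + real n)} u) \<partial>lborel) =
        (\<integral>\<^sup>+s. ennreal (enn2real (g (T s)) * (2 * ((coord b y + s) / l b)) * indicator {s0..s0 + real n} s) \<partial>lborel)"
      proof (rule nn_integral_substitution)
        show "set_borel_measurable borel {T s0..T (s0 + real n)} (\<lambda>u. enn2real (g u))"
          unfolding set_borel_measurable_def by measurable
        show "(T has_real_derivative 2 * ((coord b y + x) / l b)) (at x)" for x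
          unfolding T_def using l by (auto intro!: derivative_eq_intros simp: field_simps)
        show "continuous_on {s0..s0 + real n} (\<lambda>s. 2 * ((coord b y + s) / l b))"
          by (intro continuous_intros) (use l in auto)
        show "0 \<le> 2 * ((coord b y + x) / l b)" if "x \<in> {s0..s0 + real n}" for x
          using that l by (auto simp: s0_def max_def split: if_splits)
      qed auto
      moreover have "ennreal (r * indicator A u) = ennreal r * indicator A u" for r u :: real and A
        by (simp add: indicator_def)
      ultimately show ?thesis by (simp only:)
    qed
    moreover have "ennreal (enn2real (g (T s)) * (2 * ((coord b y + s) / l b))) * indicator {s0..s0 + real n} s
        = 2 * (g (T s) * ennreal ((coord b y + s) / l b) * indicator {s0..s0 + real n} s)" for s
    proof (cases "s0 \<le> s")
      case True
      then have "ennreal (enn2real (g (T s)) * (2 * r)) = 2 * (g (T s) * ennreal r)" if "0 \<le> r" for r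
        using that g_finite[of "T s"] by (simp add: ennreal_mult ac_simps less_top)
      moreover have "0 \<le> (coord b y + s) / l b"
        using True l by (auto simp: s0_def max_def split: if_splits)
      ultimately show ?thesis by (simp only: mult.assoc)
    qed simp
    ultimately show ?thesis
      using g_finite T0 by (simp add: less_top nn_integral_cmult)
  qed
  have "(\<integral>\<^sup>+u. (if quad y \<le> u then g u else 0) \<partial>lborel)
      = (\<integral>\<^sup>+u. (SUP n. g u * indicator {quad y..T (s0 + real n)} u) \<partial>lborel)"
  proof (rule nn_integral_cong)
    fix u
    obtain n :: nat where n: "real n > \<bar>u - quad y\<bar> * l b + 1"
      using reals_Archimedean2 by blast
    have "(u - quad y) * l b \<le> (real n)\<^sup>2"
    proof -
      have "(u - quad y) * l b \<le> \<bar>u - quad y\<bar> * l b"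
        using l by (intro mult_right_mono) auto
      also have "\<dots> \<le> real n" using n by simp
      also have "real n \<le> (real n)\<^sup>2"
        unfolding power2_eq_square by (metis le_square of_nat_le_iff of_nat_mult)
      finally show ?thesis .
    qed
    then have "u \<le> quad y + (real n)\<^sup>2 / l b"
      using l by (simp add: field_simps)
    with Tge[of "real n"] have "u \<le> T (s0 + real n)" by simp
    then have "quad y \<le> u \<Longrightarrow> g u \<le> (SUP n. g u * indicator {quad y..T (s0 + real n)} u)"
      by (intro SUP_upper2[of n]) auto
    then show "(if quad y \<le> u then g u else 0) = (SUP n. g u * indicator {quad y..T (s0 + real n)} u)"
      by (intro antisym) (auto intro!: SUP_least simp: indicator_def)
  qed
  also have "\<dots> = (SUP n. \<integral>\<^sup>+u. g u * indicator {quad y..T (s0 + real n)} u \<partial>lborel)"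
  proof (rule nn_integral_monotone_convergence_SUP)
    have mono: "T (s0 + real n) \<le> T (s0 + real k)" if "n \<le> k" for n k
    proof -
      have "2 * (s0 + real n) * coord b y + (s0 + real n)\<^sup>2 \<le> 2 * (s0 + real k) * coord b y + (s0 + real k)\<^sup>2"
      proof -
        have "0 \<le> (real k - real n) * (2 * coord b y + 2 * s0 + real n + real k)"
          using that by (intro mult_nonneg_nonneg) (auto simp: s0_def)
        then show ?thesis by (simp add: power2_eq_square algebra_simps)
      qed
      then show ?thesis using l by (simp add: T_def divide_right_mono)
    qed
    show "incseq (\<lambda>n u. g u * indicator {quad y..T (s0 + real n)} u)"
    proof (rule incseq_SucI, rule le_funI)
      fix n u
      show "g u * indicator {quad y..T (s0 + real n)} u
          \<le> g u * indicator {quad y..T (s0 + real (Suc n))} u"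
        using mono[of n "Suc n"] by (auto simp: indicator_def)
    qed
  qed simp
  also have "\<dots> = (SUP n. 2 * (\<integral>\<^sup>+s. g (T s) * ennreal ((coord b y + s) / l b) * indicator {s0..s0 + real n} s \<partial>lborel))"
    unfolding step ..
  also have "\<dots> = 2 * (\<integral>\<^sup>+s. (SUP n. g (T s) * ennreal ((coord b y + s) / l b) * indicator {s0..s0 + real n} s) \<partial>lborel)"
    (is "_ = 2 * ?I")
  proof (subst SUP_mult_left_ennreal[symmetric], subst nn_integral_monotone_convergence_SUP[symmetric])
    show "incseq (\<lambda>n s. g (T s) * ennreal ((coord b y + s) / l b) * indicator {s0..s0 + real n} s)"
      by (rule incseq_SucI, rule le_funI) (auto simp: indicator_def)
    show "(\<lambda>s. g (T s) * ennreal ((coord b y + s) / l b) * indicator {s0..s0 + real n} s)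
      \<in> borel_measurable lborel" for n
      unfolding T_def by measurable
  qed simp
  also have "?I = (\<integral>\<^sup>+s. (if s0 \<le> s then g (T s) * ennreal ((coord b y + s) / l b) else 0) \<partial>lborel)"
  proof (rule nn_integral_cong)
    fix s
    obtain n :: nat where "s \<le> s0 + real n"
      using real_arch_simple[of "s - s0"] by (auto simp: algebra_simps)
    then have "s0 \<le> s \<Longrightarrow> g (T s) * ennreal ((coord b y + s) / l b)
        \<le> (SUP n. g (T s) * ennreal ((coord b y + s) / l b) * indicator {s0..s0 + real n} s)"
      by (intro SUP_upper2[of n]) auto
    then show "(SUP n. g (T s) * ennreal ((coord b y + s) / l b) * indicator {s0..s0 + real n} s)
        = (if s0 \<le> s then g (T s) * ennreal ((coord b y + s) / l b) else 0)"
      by (intro antisym) (auto intro!: SUP_least simp: indicator_def)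
  qed
  finally have "tail (quad y) = 2 * (\<integral>\<^sup>+s. (if s0 \<le> s
      then g (T s) * ennreal ((coord b y + s) / l b) else 0) \<partial>lborel) / 2"
    unfolding tail_def by simp
  moreover have "2 * x / 2 = x" for x :: ennreal
    using ennreal_mult_divide_eq[of 2 x] by (simp add: mult.commute)
  ultimately show ?thesis
    unfolding T s0_def by simp
qed

text \<open>The inner integral runs over the chord from \<open>y\<close> back to its mirror image.
  Put x = y - s b and exchange the integrals: the constraint 0 \<le> s \<le> 2
  (\<open>coord b x\<close> + s) says that s is at least the maximum of 0 and
  \<open>- 2 * coord b x\<close>, so the points y whose chords pass through x form exactly the ray
  of \<open>tail_eq_line_integral\<close>. Where \<open>coord b y\<close> is negative,
  \<open>ennreal\<close> makes the integrand 0.\<close>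

lemma nn_integral_N_eq:
  fixes k :: "'a \<Rightarrow> ennreal"
  assumes b: "b \<in> Basis" and [measurable]: "k \<in> borel_measurable borel"
  shows "l b * (\<integral>\<^sup>+y. k y \<partial>N) =
    (\<integral>\<^sup>+y. ennreal (coord b y) * (\<integral>\<^sup>+s. k (y - s *\<^sub>R b) * indicator {0..2 * coord b y} s \<partial>lborel) \<partial>P)"
proof -
  have l: "l b > 0" using b l_pos by blast
  have m: "coord b (y + s *\<^sub>R b) = coord b y + s" for y s
    using b by (simp add: coord_def inner_add_left inner_diff_left)
  have "(\<integral>\<^sup>+y. ennreal (coord b y) * (\<integral>\<^sup>+s. k (y - s *\<^sub>R b) * indicator {0..2 * coord b y} s \<partial>lborel) \<partial>P)
     = (\<integral>\<^sup>+y. \<integral>\<^sup>+s. g (quad y) * ennreal (coord b y) * (k (y - s *\<^sub>R b) * (if 0 \<le> s \<and> s \<le> 2 * coord b y then 1 else 0))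
        \<partial>lborel \<partial>lborel)"
    unfolding P_def
    by (simp add: nn_integral_density nn_integral_cmult indicator_def of_bool_def mult.assoc cong: nn_integral_cong)
  also have "\<dots> = (\<integral>\<^sup>+s. \<integral>\<^sup>+y. g (quad y) * ennreal (coord b y) * (k (y - s *\<^sub>R b) * (if 0 \<le> s \<and> s \<le> 2 * coord b y then 1 else 0))
        \<partial>lborel \<partial>lborel)"
    by (rule lborel_pair.Fubini') measurable
  also have "\<dots> = (\<integral>\<^sup>+s. \<integral>\<^sup>+x. g (quad (x + s *\<^sub>R b)) * ennreal (coord b x + s) *
      (k x * (if 0 \<le> s \<and> s \<le> 2 * (coord b x + s) then 1 else 0)) \<partial>lborel \<partial>lborel)"
  proof (rule nn_integral_cong)
    fix s :: real
    show "(\<integral>\<^sup>+y. g (quad y) * ennreal (coord b y) *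
          (k (y - s *\<^sub>R b) * (if 0 \<le> s \<and> s \<le> 2 * coord b y then 1 else 0)) \<partial>lborel)
      = (\<integral>\<^sup>+x. g (quad (x + s *\<^sub>R b)) * ennreal (coord b x + s) *
          (k x * (if 0 \<le> s \<and> s \<le> 2 * (coord b x + s) then 1 else 0)) \<partial>lborel)"
      by (subst nn_integral_lborel_translate[symmetric, where c = "s *\<^sub>R b"]) (simp_all add: m)
  qed
  also have "\<dots> = (\<integral>\<^sup>+x. \<integral>\<^sup>+s. g (quad (x + s *\<^sub>R b)) * ennreal (coord b x + s) *
      (k x * (if 0 \<le> s \<and> s \<le> 2 * (coord b x + s) then 1 else 0)) \<partial>lborel \<partial>lborel)"
    by (rule lborel_pair.Fubini') measurable
  also have "\<dots> = (\<integral>\<^sup>+x. l b * (tail (quad x) * k x) \<partial>lborel)"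
  proof (rule nn_integral_cong)
    fix x
    have "(\<integral>\<^sup>+s. g (quad (x + s *\<^sub>R b)) * ennreal (coord b x + s) *
        (k x * (if 0 \<le> s \<and> s \<le> 2 * (coord b x + s) then 1 else 0)) \<partial>lborel)
      = (\<integral>\<^sup>+s. (l b * k x) * (if max 0 (- 2 * coord b x) \<le> s
        then g (quad (x + s *\<^sub>R b)) * ennreal ((coord b x + s) / l b) else 0) \<partial>lborel)"
    proof (rule nn_integral_cong)
      fix s
      have "ennreal (coord b x + s) = ennreal (l b) * ennreal ((coord b x + s) / l b)" if "coord b x + s \<ge> 0"
        using l that by (simp flip: ennreal_mult')
      then show "g (quad (x + s *\<^sub>R b)) * ennreal (coord b x + s) *
          (k x * (if 0 \<le> s \<and> s \<le> 2 * (coord b x + s) then 1 else 0)) = (l b * k x) *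
          (if max 0 (- 2 * coord b x) \<le> s
            then g (quad (x + s *\<^sub>R b)) * ennreal ((coord b x + s) / l b) else 0)"
        by (auto simp: ac_simps)
    qed
    also have "\<dots> = (l b * k x) * tail (quad x)"
      unfolding tail_eq_line_integral[OF b] by (rule nn_integral_cmult) measurable
    finally show "(\<integral>\<^sup>+s. g (quad (x + s *\<^sub>R b)) * ennreal (coord b x + s) *
        (k x * (if 0 \<le> s \<and> s \<le> 2 * (coord b x + s) then 1 else 0)) \<partial>lborel) = l b * (tail (quad x) * k x)"
      by (simp add: ac_simps)
  qed
  also have "\<dots> = l b * (\<integral>\<^sup>+x. tail (quad x) * k x \<partial>lborel)"
    by (rule nn_integral_cmult) measurable
  finally show ?thesis
    by (simp add: N_def nn_integral_density)
qed

text \<open>The reflection preserves \<open>P\<close> and changes the sign of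
  \<open>coord b\<close>, so the negative half space can be folded onto the positive one. What
  remains is the increment of \<open>h\<close> across a chord.\<close>

lemma integral_eq_half_line_integral:
  fixes h :: "'a \<Rightarrow> real"
  assumes b: "b \<in> Basis"
  assumes int: "integrable P (\<lambda>y. coord b y * h y)"
  shows "integrable P (\<lambda>y. max 0 (coord b y) * (h y - h (reflection b y)))" (is ?int)
    and "(\<integral>y. coord b y * h y \<partial>P) = (\<integral>y. max 0 (coord b y) * (h y - h (reflection b y)) \<partial>P)" (is ?eq)
proof -
  have pos: "integrable P (\<lambda>y. of_bool (coord b y > 0) * (coord b y * h y))"
    and neg: "integrable P (\<lambda>y. of_bool (coord b y < 0) * (coord b y * h y))"
    using integrable_real_mult_indicator[OF _ int, of "{y. coord b y > 0}"]
      integrable_real_mult_indicator[OF _ int, of "{y. coord b y < 0}"]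
    by (simp_all add: indicator_def of_bool_def mult.commute)
  have [measurable]: "(\<lambda>y. of_bool (coord b y < 0) * (coord b y * h y)) \<in> borel_measurable borel"
    using borel_measurable_integrable[OF neg] by simp
  note m = coord_reflection[OF b]
  have neg': "integrable P (\<lambda>y. of_bool (coord b y > 0) * (- coord b y * h (reflection b y)))"
    using neg by (subst (asm) distr_reflection[OF b, symmetric])
      (simp add: integrable_distr_eq m)
  have "(\<integral>y. of_bool (coord b y < 0) * (coord b y * h y) \<partial>P)
      = (\<integral>y. of_bool (coord b y < 0) * (coord b y * h y) \<partial>distr P borel (reflection b))"
    by (simp add: distr_reflection[OF b])
  also have "\<dots> = (\<integral>y. of_bool (coord b y > 0) * (- coord b y * h (reflection b y)) \<partial>P)"
    by (subst integral_distr) (simp_all add: m)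
  finally have refl: "(\<integral>y. of_bool (coord b y < 0) * (coord b y * h y) \<partial>P)
    = (\<integral>y. of_bool (coord b y > 0) * (- coord b y * h (reflection b y)) \<partial>P)" .
  have eq: "max 0 (coord b y) * (h y - h (reflection b y)) =
      of_bool (coord b y > 0) * (coord b y * h y) + of_bool (coord b y > 0) * (- coord b y * h (reflection b y))" for y
    by (simp add: max_def algebra_simps)
  show ?int
    unfolding eq by (rule Bochner_Integration.integrable_add[OF pos neg'])
  have "(\<integral>y. coord b y * h y \<partial>P)
      = (\<integral>y. of_bool (coord b y > 0) * (coord b y * h y) + of_bool (coord b y < 0) * (coord b y * h y) \<partial>P)"
    by (rule Bochner_Integration.integral_cong) auto
  also have "\<dots> = (\<integral>y. max 0 (coord b y) * (h y - h (reflection b y)) \<partial>P)"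
    unfolding eq using pos neg neg' by (simp add: refl)
  finally show ?eq .
qed

text \<open>This is the chord formula for the constant 1: a chord has length
  \<open>2 * coord b y\<close>, and the 2 accounts for the two equal half spaces. It shows that one
  finite second moment makes \<open>N\<close> finite, and a finite \<open>N\<close> in turn controls
  the second moments in all other directions.\<close>

lemma nn_integral_coord_square:
  assumes b: "b \<in> Basis"
  shows "(\<integral>\<^sup>+y. ennreal ((coord b y)\<^sup>2) \<partial>P) = l b * emeasure N UNIV"
proof -
  note m = coord_reflection[OF b]
  have "(\<integral>\<^sup>+y. ennreal ((coord b y)\<^sup>2) \<partial>P)
      = (\<integral>\<^sup>+y. of_bool (coord b y > 0) * ennreal ((coord b y)\<^sup>2) + of_bool (coord b y < 0) * ennreal ((coord b y)\<^sup>2) \<partial>P)"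
    by (rule nn_integral_cong) (auto simp: not_less)
  also have "\<dots> = (\<integral>\<^sup>+y. of_bool (coord b y > 0) * ennreal ((coord b y)\<^sup>2) \<partial>P)
      + (\<integral>\<^sup>+y. of_bool (coord b y < 0) * ennreal ((coord b y)\<^sup>2) \<partial>P)"
    by (rule nn_integral_add) measurable
  also have "(\<integral>\<^sup>+y. of_bool (coord b y < 0) * ennreal ((coord b y)\<^sup>2) \<partial>P)
      = (\<integral>\<^sup>+y. of_bool (coord b y < 0) * ennreal ((coord b y)\<^sup>2) \<partial>distr P borel (reflection b))"
    by (simp add: distr_reflection[OF b])
  also have "\<dots> = (\<integral>\<^sup>+y. of_bool (coord b y > 0) * ennreal ((coord b y)\<^sup>2) \<partial>P)"
    by (subst nn_integral_distr) (simp_all add: m)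
  also have "(\<integral>\<^sup>+y. of_bool (coord b y > 0) * ennreal ((coord b y)\<^sup>2) \<partial>P)
      + (\<integral>\<^sup>+y. of_bool (coord b y > 0) * ennreal ((coord b y)\<^sup>2) \<partial>P)
      = (\<integral>\<^sup>+y. of_bool (coord b y > 0) * ennreal ((coord b y)\<^sup>2) + of_bool (coord b y > 0) * ennreal ((coord b y)\<^sup>2) \<partial>P)"
    by (rule nn_integral_add[symmetric]) measurable
  also have "\<dots> = (\<integral>\<^sup>+y. ennreal (coord b y) * (\<integral>\<^sup>+s. 1 * indicator {0..2 * coord b y} s \<partial>lborel) \<partial>P)"
  proof (rule nn_integral_cong)
    fix y
    show "of_bool (coord b y > 0) * ennreal ((coord b y)\<^sup>2) + of_bool (coord b y > 0) * ennreal ((coord b y)\<^sup>2)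
        = ennreal (coord b y) * (\<integral>\<^sup>+s. 1 * indicator {0..2 * coord b y} s \<partial>lborel)"
    proof (cases "coord b y > 0")
      case True
      then show ?thesis by (simp add: power2_eq_square flip: ennreal_mult' ennreal_plus)
    qed (simp add: ennreal_neg)
  qed
  also have "\<dots> = l b * (\<integral>\<^sup>+y. 1 \<partial>N)"
    by (rule nn_integral_N_eq[OF b, symmetric]) simp
  finally show ?thesis by simp
qed

lemma emeasure_N_eq:
  assumes b: "b \<in> Basis" and int: "integrable P (\<lambda>y. (coord b y)\<^sup>2)"
  shows "l b * emeasure N UNIV = ennreal (\<integral>y. (coord b y)\<^sup>2 \<partial>P)"
  using nn_integral_coord_square[OF b] nn_integral_eq_integral[OF int] by simp

lemma finite_measure_N:
  assumes "b \<in> Basis" "integrable P (\<lambda>y. (coord b y)\<^sup>2)"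
  shows "finite_measure N"
proof
  have "ennreal (l b) * emeasure N UNIV < \<infinity>" "ennreal (l b) \<noteq> 0"
    using emeasure_N_eq[OF assms] l_pos[OF assms(1)] by auto
  then show "emeasure N (space N) \<noteq> \<infinity>"
    by (auto simp: ennreal_mult_less_top)
qed

text \<open>The assumption \<open>line\<close> is an integrated form of "the derivative of
  \<open>h\<close> along \<open>b\<close> is at least \<open>k\<close>". After folding, the
  increment of \<open>h\<close> across each chord is bounded below by the chord integral of
  \<open>k\<close>, and \<open>nn_integral_N_eq\<close> collects these integrals. The
  almost-everywhere quantifier stands outside the quantifier over t because the chord length depends
  on \<open>y\<close>.\<close>

lemma stein_inequality:
  fixes h k :: "'a \<Rightarrow> real"
  assumes b: "b \<in> Basis"
  assumes int2: "integrable P (\<lambda>y. (coord b y)\<^sup>2)"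
    and int: "integrable P (\<lambda>y. coord b y * h y)"
    and k [measurable]: "k \<in> borel_measurable borel" and k_bound: "\<And>y. \<bar>k y\<bar> \<le> M"
    and line: "AE y in lborel. \<forall>t>0. \<exists>I. ((\<lambda>s. k (y - s *\<^sub>R b)) has_integral I) {0..t}
      \<and> I \<le> h y - h (y - t *\<^sub>R b)"
  shows "l b * (\<integral>y. k y \<partial>N) \<le> (\<integral>y. coord b y * h y \<partial>P)"
proof -
  have l: "l b > 0" using b l_pos by blast
  interpret N: finite_measure N
    using finite_measure_N b int2 by blast
  note m = coord_reflection[OF b]
  note half = integral_eq_half_line_integral[OF b, OF int]
  \<comment> \<open>Adding \<open>M\<close> to \<open>k\<close> corresponds to adding
    \<open>M * coord b\<close> to \<open>h\<close>. Both sides of the claim then grow by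
    \<open>M * (l b * measure N UNIV)\<close>, by the second moment identity, so the shift cancels
    at the end.\<close>
  have int3: "integrable P (\<lambda>y. coord b y * (h y + M * coord b y))"
    using int int2 by (simp add: distrib_left power2_eq_square mult.left_commute)
  note half3 = integral_eq_half_line_integral[OF b, OF int3]
  have k_int: "integrable N k"
    by (rule N.integrable_const_bound[of _ M]) (use k_bound in auto)
  have "(\<integral>y. (coord b y)\<^sup>2 \<partial>P) = l b * measure N UNIV"
  proof -
    have "ennreal (l b * measure N UNIV) = ennreal (\<integral>y. (coord b y)\<^sup>2 \<partial>P)"
      using emeasure_N_eq[OF b] int2 l N.emeasure_eq_measure[of UNIV]
      by (simp add: ennreal_mult)
    then show ?thesis using l by simp
  qed
  moreover have "(\<integral>y. coord b y * (h y + M * coord b y) \<partial>P) = (\<integral>y. coord b y * h y \<partial>P) + M * (\<integral>y. (coord b y)\<^sup>2 \<partial>P)"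
    using int int2 by (simp add: distrib_left power2_eq_square mult.left_commute)
  ultimately have sum_eq: "(\<integral>y. coord b y * (h y + M * coord b y) \<partial>P)
      = (\<integral>y. coord b y * h y \<partial>P) + M * (l b * measure N UNIV)"
    by simp
  have nonneg: "AE y in P. 0 \<le> max 0 (coord b y) *
      ((h y + M * coord b y) - (h (reflection b y) + M * coord b (reflection b y)))"
  proof (rule AE_P, use line in eventually_elim)
    case (elim y)
    show ?case
    proof (cases "coord b y > 0")
      case True
      then obtain I where I: "((\<lambda>s. k (y - s *\<^sub>R b)) has_integral I) {0..2 * coord b y}"
        "I \<le> h y - h (y - (2 * coord b y) *\<^sub>R b)"
        using elim[rule_format, of "2 * coord b y"] by auto
      have "- (2 * coord b y * M) \<le> I"
        using has_integral_le[OF has_integral_const_real[of "-M" 0 "2 * coord b y"] I(1)] k_bound True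
        by (simp add: abs_le_iff minus_le_iff)
      then show ?thesis
        using I(2) unfolding m
          by (intro mult_nonneg_nonneg) (simp_all add: reflection_def algebra_simps)
    qed simp
  qed
  \<comment> \<open>The shift by \<open>M\<close> makes the integrand nonnegative, so that Tonelli's theorem applies.\<close>
  have "l b * (\<integral>\<^sup>+y. ennreal (k y + M) \<partial>N)
      = (\<integral>\<^sup>+y. ennreal (coord b y) * (\<integral>\<^sup>+s. ennreal (k (y - s *\<^sub>R b) + M) * indicator {0..2 * coord b y} s \<partial>lborel) \<partial>P)"
    by (rule nn_integral_N_eq[OF b]) simp
  also have "\<dots> \<le> (\<integral>\<^sup>+y. ennreal (max 0 (coord b y) *
      ((h y + M * coord b y) - (h (reflection b y) + M * coord b (reflection b y)))) \<partial>P)"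
  proof (rule nn_integral_mono_AE, rule AE_P, use line in eventually_elim)
    case (elim y)
    show ?case
    proof (cases "coord b y > 0")
      case True
      then obtain I where I: "((\<lambda>s. k (y - s *\<^sub>R b)) has_integral I) {0..2 * coord b y}"
        "I \<le> h y - h (y - (2 * coord b y) *\<^sub>R b)"
        using elim[rule_format, of "2 * coord b y"] by auto
      have J: "((\<lambda>s. k (y - s *\<^sub>R b) + M) has_integral (I + 2 * coord b y * M)) {0..2 * coord b y}"
        using has_integral_add[OF I(1) has_integral_const_real[of M 0 "2 * coord b y"]] True by simp
      have nonneg: "0 \<le> k y + M" for y
        using k_bound[of y] by (simp add: abs_le_iff)
      have "(\<integral>\<^sup>+s. ennreal (k (y - s *\<^sub>R b) + M) * indicator {0..2 * coord b y} s \<partial>lborel)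
          = (\<integral>\<^sup>+s. ennreal ((if s \<in> {0..2 * coord b y} then k (y - s *\<^sub>R b) + M else 0)) \<partial>lborel)"
        by (rule nn_integral_cong) (simp add: indicator_def)
      also have "\<dots> = ennreal (I + 2 * coord b y * M)"
      proof (rule nn_integral_has_integral_lborel)
        show "((\<lambda>s. if s \<in> {0..2 * coord b y} then k (y - s *\<^sub>R b) + M else 0) has_integral I + 2 * coord b y * M) UNIV"
          using J by (simp only: has_integral_restrict_UNIV)
      qed (use nonneg in auto)
      also have "\<dots> \<le> ennreal ((h y + M * coord b y) - (h (reflection b y) + M * coord b (reflection b y)))"
        using I(2) unfolding m by (intro ennreal_leI) (simp add: reflection_def algebra_simps)
      finally show ?thesis
        using True by (simp add: ennreal_mult' mult_left_mono)
    qed (simp add: ennreal_neg)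
  qed
  also have "\<dots> = ennreal (\<integral>y. max 0 (coord b y) *
      ((h y + M * coord b y) - (h (reflection b y) + M * coord b (reflection b y))) \<partial>P)"
    by (rule nn_integral_eq_integral[OF half3(1) nonneg])
  also have "\<dots> = ennreal (\<integral>y. coord b y * (h y + M * coord b y) \<partial>P)"
    unfolding half3(2) ..
  also note sum_eq
  finally have "l b * (\<integral>\<^sup>+y. ennreal (k y + M) \<partial>N)
      \<le> ennreal ((\<integral>y. coord b y * h y \<partial>P) + M * (l b * measure N UNIV))" .
  moreover have "(\<integral>\<^sup>+y. ennreal (k y + M) \<partial>N) = ennreal ((\<integral>y. k y \<partial>N) + M * measure N UNIV)"
  proof -
    have "(\<integral>\<^sup>+y. ennreal (k y + M) \<partial>N) = ennreal (\<integral>y. k y + M \<partial>N)"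
    proof (rule nn_integral_eq_integral)
      show "AE y in N. 0 \<le> k y + M"
      proof (rule AE_I2)
        show "0 \<le> k y + M" for y using k_bound[of y] by (simp add: abs_le_iff)
      qed
    qed (use k_int in simp)
    also have "(\<integral>y. k y + M \<partial>N) = (\<integral>y. k y \<partial>N) + M * measure N UNIV"
      using k_int by simp
    finally show ?thesis .
  qed
  ultimately have "ennreal (l b * ((\<integral>y. k y \<partial>N) + M * measure N UNIV))
      \<le> ennreal ((\<integral>y. coord b y * h y \<partial>P) + M * (l b * measure N UNIV))"
    using l by (simp add: ennreal_mult')
  moreover have "0 \<le> (\<integral>y. coord b y * h y \<partial>P) + M * (l b * measure N UNIV)"
    using integral_nonneg_AE[OF nonneg] unfolding half3(2)[symmetric] sum_eq .
  ultimately show ?thesis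
    by (simp add: algebra_simps)
qed

end

section \<open>Increments along lines\<close>

text \<open>The gauge integral makes this work: it integrates every derivative of a continuous
  function, with finitely many exceptional points, so \<open>D\<close> may be discontinuous or
  unbounded.\<close>

lemma integral_le_increment:
  fixes H D k :: "real \<Rightarrow> real"
  assumes "finite S" "a \<le> b"
    and D: "\<And>x. x \<notin> S \<Longrightarrow> (H has_real_derivative D x) (at x)"
    and le: "\<And>x. x \<notin> S \<Longrightarrow> k x \<le> D x"
    and H: "continuous_on UNIV H" and k: "continuous_on UNIV k"
  shows "integral {a..b} k \<le> H b - H a"
proof (rule has_integral_le)
  have "k integrable_on {a..b}"
    by (rule integrable_continuous_real) (rule continuous_on_subset[OF k], simp)
  then show "(k has_integral integral {a..b} k) {a..b}"
    by (rule integrable_integral)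
  \<comment> \<open>On \<open>S\<close> nothing is known about \<open>D\<close>; putting
    \<open>k\<close> there makes the comparison hold at every point without changing the
    integral.\<close>
  show "((\<lambda>x. if x \<in> S then k x else D x) has_integral H b - H a) {a..b}"
  proof (rule fundamental_theorem_of_calculus_interior_strong)
    show "continuous_on {a..b} H"
      by (rule continuous_on_subset[OF H]) simp
  qed (use assms(1,2) D in \<open>auto simp: has_real_derivative_iff_has_vector_derivative\<close>)
qed (use le in auto)

text \<open>The same bound with the line traversed backwards from \<open>u\<close>, as in the chords
  of \<open>stein_inequality\<close>.\<close>

lemma has_integral_line_le_increment:
  fixes H D k :: "real \<Rightarrow> real"
  assumes "finite S" "t \<ge> 0"
    and D: "\<And>x. x \<notin> S \<Longrightarrow> (H has_real_derivative D x) (at x)"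
    and le: "\<And>x. x \<notin> S \<Longrightarrow> k x \<le> D x"
    and H: "continuous_on UNIV H" and k: "continuous_on UNIV k"
  shows "\<exists>I. ((\<lambda>s. k (u - s)) has_integral I) {0..t} \<and> I \<le> H u - H (u - t)"
proof -
  have "integral {0..t} (\<lambda>s. k (u - s)) \<le> - H (u - t) - - H (u - 0)"
  proof (rule integral_le_increment)
    show "finite ((\<lambda>x. u - x) ` S)" using assms(1) by simp
    show "((\<lambda>s. - H (u - s)) has_real_derivative D (u - x)) (at x)"
      if "x \<notin> (\<lambda>x. u - x) ` S" for x
    proof -
      have "u - x \<notin> S" using that by (auto simp: image_iff dest: bspec[of _ _ "u - x"])
      from DERIV_chain2[where f=H and g="\<lambda>s. u - s", OF D[OF this], of "-1"] have
        "((\<lambda>s. H (u - s)) has_real_derivative D (u - x) * -1) (at x)"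
        by (rule meta_mp) (auto intro!: derivative_eq_intros)
      from DERIV_minus[OF this] show ?thesis by simp
    qed
    show "k (u - x) \<le> D (u - x)" if "x \<notin> (\<lambda>x. u - x) ` S" for x
      using that by (intro le) (auto simp: image_iff dest: bspec[of _ _ "u - x"])
    show "continuous_on UNIV (\<lambda>s. - H (u - s))"
      by (intro continuous_on_minus continuous_on_compose2[OF H] continuous_intros) auto
    show "continuous_on UNIV (\<lambda>s. k (u - s))"
      by (intro continuous_on_compose2[OF k] continuous_intros) auto
  qed fact
  moreover have "(\<lambda>s. k (u - s)) integrable_on {0..t}"
    by (intro integrable_continuous_real continuous_on_compose2[OF k] continuous_intros) auto
  ultimately show ?thesis
    by (intro exI[of _ "integral {0..t} (\<lambda>s. k (u - s))"]) (simp add: integrable_integral)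
qed

text \<open>The bound on \<open>\<psi>'\<close> says that \<open>w \<mapsto> \<psi> w * w\<close> is nondecreasing. The value at 0 is fixed because the
  statistic \<open>W\<close> is 0 by division by zero when \<open>z = 0\<close>.\<close>

locale shrinkage_function =
  fixes \<psi> \<psi>' :: "real \<Rightarrow> real" and K M :: real
  assumes deriv: "\<And>w. w > 0 \<Longrightarrow> (\<psi> has_real_derivative \<psi>' w) (at w)"
    and deriv_ge: "\<And>w. w > 0 \<Longrightarrow> - \<psi> w \<le> \<psi>' w * w"
    and nonneg: "\<And>w. w \<ge> 0 \<Longrightarrow> 0 \<le> \<psi> w"
    and mult_le: "\<And>w. w \<ge> 0 \<Longrightarrow> \<psi> w * w \<le> K"
    and le: "\<And>w. w \<ge> 0 \<Longrightarrow> \<psi> w \<le> M"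
    and zero: "\<psi> 0 = 0"
begin

lemma K_nonneg: "0 \<le> K"
  using mult_le[of 0] by simp

lemma M_nonneg: "0 \<le> M"
  using nonneg[of 0] le[of 0] by simp

text \<open>Along a coordinate of x the statistic is W(x) = (r + e x^2)/S, so x W'(x) = 2 W(x) e
  x^2/(r + e x^2). By \<open>deriv_ge\<close> the derivative of x \<psi>(W(x)) is then at least
  \<open>k\<close>. Since r > 0, W stays in the range where \<psi> is differentiable.\<close>

lemma numerator_line:
  fixes r e S t u :: real
  assumes "r > 0" "e \<ge> 0" "S > 0" "t \<ge> 0"
  defines "\<Psi> \<equiv> \<lambda>x. \<psi> ((r + e * x\<^sup>2) / S)"
  defines "k \<equiv> \<lambda>x. \<Psi> x * (1 - 2 * (e * x\<^sup>2 / (r + e * x\<^sup>2)))"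
  shows "\<exists>I. ((\<lambda>s. k (u - s)) has_integral I) {0..t} \<and> I \<le> u * \<Psi> u - (u - t) * \<Psi> (u - t)"
proof (rule has_integral_line_le_increment[where S="{}" and H="\<lambda>x. x * \<Psi> x" and k=k])
  define W where "W x = (r + e * x\<^sup>2) / S" for x
  have pos: "r + e * x\<^sup>2 > 0" for x using assms by (intro add_pos_nonneg) auto
  have W: "W x > 0" for x using pos[of x] assms by (simp add: W_def)
  have d\<Psi>: "(\<Psi> has_real_derivative \<psi>' (W x) * (2 * e * x / S)) (at x)" for x
    unfolding \<Psi>_def W_def[symmetric]
  proof (rule DERIV_chain2[where f=\<psi> and g=W, OF deriv[OF W]])
    show "(W has_real_derivative 2 * e * x / S) (at x)"
      unfolding W_def using assms by (auto intro!: derivative_eq_intros)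
  qed
  then show "((\<lambda>x. x * \<Psi> x) has_real_derivative \<Psi> x + x * (\<psi>' (W x) * (2 * e * x / S))) (at x)" for x
    by (auto intro!: derivative_eq_intros)
  show "k x \<le> \<Psi> x + x * (\<psi>' (W x) * (2 * e * x / S))" for x
  proof -
    have "- \<psi> (W x) * (2 * (e * x\<^sup>2 / (r + e * x\<^sup>2))) \<le> \<psi>' (W x) * W x * (2 * (e * x\<^sup>2 / (r + e * x\<^sup>2)))"
      using deriv_ge[OF W] pos[of x] assms by (intro mult_right_mono) auto
    also have "\<dots> = x * (\<psi>' (W x) * (2 * e * x / S))"
      using pos[of x] by (simp add: W_def power2_eq_square)
    finally show ?thesis
      by (simp add: k_def \<Psi>_def W_def algebra_simps)
  qed
  have c: "continuous_on UNIV \<Psi>"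
    by (rule continuous_at_imp_continuous_on) (use DERIV_isCont[OF d\<Psi>] in blast)
  then show "continuous_on UNIV (\<lambda>x. x * \<Psi> x)"
    by (intro continuous_intros)
  show "continuous_on UNIV k"
  proof -
    have "r + e * x\<^sup>2 \<noteq> 0" for x using pos[of x] by simp
    then show ?thesis
      unfolding k_def by (intro continuous_intros c) auto
  qed
qed (use \<open>t \<ge> 0\<close> in auto)

text \<open>Along a coordinate of z the statistic is W(x) = Y/(r + x^2), with x W'(x) = - c W(x) and
  c = 2 x^2/(r + x^2). Differentiating x \<psi>^2 W gives two terms; the explicit one contributes -c
  B, and \<open>deriv_ge\<close> bounds the one with \<psi>' by 2 c B, leaving at most (1 + c) B.
  The minus signs make this a lower bound. The case r = 0 occurs for a one-dimensional z, when the
  line crosses the pole of W at x = 0.\<close>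

lemma denominator_line:
  fixes r Y t u :: real
  assumes "r \<ge> 0" "Y > 0" "t \<ge> 0"
  defines "B \<equiv> \<lambda>x. (\<psi> (Y / (r + x\<^sup>2)))\<^sup>2 * (Y / (r + x\<^sup>2))"
  defines "k \<equiv> \<lambda>x. - (B x * (1 + 2 * (x\<^sup>2 / (r + x\<^sup>2))))"
  shows "\<exists>I. ((\<lambda>s. k (u - s)) has_integral I) {0..t} \<and> I \<le> - (u * B u) - - ((u - t) * B (u - t))"
proof (rule has_integral_line_le_increment[where H="\<lambda>x. - (x * B x)" and k=k and S="if r = 0 then {0} else {}"])
  define W where "W x = Y / (r + x\<^sup>2)" for x
  define \<Psi> where "\<Psi> x = \<psi> (W x)" for x
  let ?S = "if r = 0 then {0} else {} :: real set"
  have pos: "r + x\<^sup>2 > 0" if "x \<notin> ?S" for x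
    using that \<open>r \<ge> 0\<close> by (cases "r = 0") (auto intro: add_pos_nonneg)
  have W: "W x > 0" if "x \<notin> ?S" for x
    using pos[OF that] assms by (simp add: W_def)
  have W_nonneg: "W x \<ge> 0" for x using assms by (simp add: W_def)
  define W' where "W' x = - (2 * x / (r + x\<^sup>2)) * W x" for x
  have dW: "(W has_real_derivative W' x) (at x)" if "x \<notin> ?S" for x
    unfolding W_def W'_def
    using pos[OF that] by (auto intro!: derivative_eq_intros simp: power2_eq_square)
  have d\<Psi>: "(\<Psi> has_real_derivative \<psi>' (W x) * W' x) (at x)" if "x \<notin> ?S" for x
    unfolding \<Psi>_def by (rule DERIV_chain2[where f=\<psi> and g=W, OF deriv[OF W[OF that]] dW[OF that]])
  have B: "B = (\<lambda>x. (\<Psi> x)\<^sup>2 * W x)"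
    by (simp add: B_def \<Psi>_def W_def)
  define D where "D x = (\<Psi> x)\<^sup>2 * W' x + 2 * \<Psi> x * (\<psi>' (W x) * W' x) * W x" for x
  have dB: "(B has_real_derivative D x) (at x)" if "x \<notin> ?S" for x
    unfolding B D_def
    by (rule derivative_eq_intros d\<Psi>[OF that] dW[OF that] refl)+ simp
  show "((\<lambda>x. - (x * B x)) has_real_derivative - (B x + x * D x)) (at x)" if "x \<notin> ?S" for x
    using dB[OF that] by (auto intro!: derivative_eq_intros)
  show "k x \<le> - (B x + x * D x)" if "x \<notin> ?S" for x
  proof -
    define c where "c = 2 * (x\<^sup>2 / (r + x\<^sup>2))"
    have xW': "x * W' x = - c * W x"
      by (simp add: W'_def c_def power2_eq_square)
    have "x * D x = - c * B x - 2 * \<Psi> x * c * W x * (\<psi>' (W x) * W x)"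
    proof -
      have "x * D x = (\<Psi> x)\<^sup>2 * (x * W' x) + 2 * \<Psi> x * (\<psi>' (W x) * (x * W' x)) * W x"
        by (simp add: D_def algebra_simps)
      then show ?thesis
        unfolding xW' by (simp add: B algebra_simps)
    qed
    also have "\<dots> \<le> - c * B x - 2 * \<Psi> x * c * W x * (- \<Psi> x)"
    proof -
      have "0 \<le> 2 * \<Psi> x * c * W x"
        using nonneg[OF W_nonneg] W_nonneg pos[OF that] by (simp add: \<Psi>_def c_def)
      from mult_left_mono[OF deriv_ge[OF W[OF that]] this] show ?thesis
        by (simp add: \<Psi>_def)
    qed
    also have "\<dots> = c * B x"
      by (simp add: B power2_eq_square)
    finally show ?thesis by (simp add: k_def c_def algebra_simps)
  qed
  have B_nonneg: "0 \<le> B x" for x using W_nonneg[of x] by (simp add: B)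
  \<comment> \<open>Write \<psi>^2 W as (\<psi> W)^2 / W and use \<psi> W \<le> K. At the pole this
    forces B to tend to 0, which is also its value there by the convention on division by
    zero.\<close>
  have B_le: "B x \<le> K\<^sup>2 * (r + x\<^sup>2) / Y" for x
  proof (cases "x \<in> ?S")
    case False
    have "B x = (\<Psi> x * W x)\<^sup>2 * (r + x\<^sup>2) / Y"
      using pos[OF False] \<open>Y > 0\<close> by (simp add: B_def \<Psi>_def W_def power_divide power_mult_distrib power2_eq_square[of "r + x\<^sup>2"]
          power2_eq_square[of Y])
    also have "\<dots> \<le> K\<^sup>2 * (r + x\<^sup>2) / Y"
      using nonneg[OF W_nonneg] W_nonneg mult_le[OF W_nonneg] pos[OF False] assms
      by (intro divide_right_mono mult_right_mono power_mono) (auto simp: \<Psi>_def)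
    finally show ?thesis .
  next
    case True
    then have "r = 0" "x = 0" by (auto split: if_splits)
    then show ?thesis by (simp add: B_def)
  qed
  have c_bound: "0 \<le> x\<^sup>2 / (r + x\<^sup>2)" "x\<^sup>2 / (r + x\<^sup>2) \<le> 1" for x
  proof -
    have "0 \<le> r + x\<^sup>2" using \<open>r \<ge> 0\<close> by simp
    then show "0 \<le> x\<^sup>2 / (r + x\<^sup>2)" by simp
    show "x\<^sup>2 / (r + x\<^sup>2) \<le> 1"
    proof (cases "r + x\<^sup>2 = 0")
      case False
      with \<open>0 \<le> r + x\<^sup>2\<close> have "0 < r + x\<^sup>2" by linarith
      with \<open>r \<ge> 0\<close> show ?thesis by (simp add: divide_le_eq_1_pos)
    qed simp
  qed
  \<comment> \<open>The bound 3 + |x| covers both multipliers used below: x itself, and 1 + 2 x^2/(r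
    + x^2), which never exceeds 3.\<close>
  have cont: "continuous_on UNIV (\<lambda>x. B x * v x)"
    if v: "\<And>x. x \<notin> ?S \<Longrightarrow> isCont v x" and v_le: "\<And>x. \<bar>v x\<bar> \<le> 3 + \<bar>x\<bar>" for v
  proof (rule continuous_at_imp_continuous_on, rule ballI)
    fix x
    show "isCont (\<lambda>x. B x * v x) x"
    proof (cases "x \<in> ?S")
      case False
      show ?thesis
        by (rule isCont_mult[OF DERIV_isCont[OF dB[OF False]] v[OF False]])
    next
      case True
      then have [simp]: "r = 0" "x = 0" by (auto split: if_splits)
      have "(\<lambda>x. K\<^sup>2 * (r + x\<^sup>2) / Y * (3 + \<bar>x\<bar>)) \<midarrow>0\<rightarrow> K\<^sup>2 * (0 + 0\<^sup>2) / Y * (3 + \<bar>0\<bar>)"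
        using assms by (intro tendsto_intros) auto
      then have lim: "(\<lambda>x. K\<^sup>2 * (r + x\<^sup>2) / Y * (3 + \<bar>x\<bar>)) \<midarrow>0\<rightarrow> 0" by simp
      have "(\<lambda>x. B x * v x) \<midarrow>0\<rightarrow> 0"
      proof (rule Lim_null_comparison[OF always_eventually lim], rule allI)
        fix x
        show "norm (B x * v x) \<le> K\<^sup>2 * (r + x\<^sup>2) / Y * (3 + \<bar>x\<bar>)"
          unfolding real_norm_def abs_mult
          using B_nonneg[of x] B_le[of x] v_le[of x] by (intro mult_mono) auto
      qed
      then show ?thesis by (simp add: isCont_def B_def)
    qed
  qed
  show "continuous_on UNIV (\<lambda>x. - (x * B x))"
    using cont[of "\<lambda>x. x"] by (intro continuous_on_minus) (simp add: mult.commute)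
  show "continuous_on UNIV k"
    unfolding k_def
  proof (rule continuous_on_minus, rule cont)
    show "isCont (\<lambda>x. 1 + 2 * (x\<^sup>2 / (r + x\<^sup>2))) x" if "x \<notin> ?S" for x
      using pos[OF that] by (intro continuous_intros) auto
    show "\<bar>1 + 2 * (x\<^sup>2 / (r + x\<^sup>2))\<bar> \<le> 3 + \<bar>x\<bar>" for x
      using c_bound[of x] by (simp add: abs_le_iff)
  qed
qed (use \<open>t \<ge> 0\<close> in auto)

end

section \<open>Risk of the regularised estimator\<close>

lemma borel_measurable_fst_nth [measurable]:
  "(\<lambda>w :: (real ^ 'p) \<times> (real ^ 'n). fst w $ i) \<in> borel_measurable borel"
  by (intro borel_measurable_continuous_onI continuous_intros)

lemma borel_measurable_snd_nth [measurable]: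
  "(\<lambda>w :: (real ^ 'p) \<times> (real ^ 'n). snd w $ k) \<in> borel_measurable borel"
  by (intro borel_measurable_continuous_onI continuous_intros)

lemma real_fraction_le_one: "0 \<le> a \<Longrightarrow> a \<le> b \<Longrightarrow> a / b \<le> (1 :: real)"
  unfolding divide_le_eq_1 by linarith

text \<open>Here \<open>v\<close> holds the weights of the loss, so that v_i d_i / c_i becomes
  d_i^(1-j) / c_i. \<open>K\<close> bounds the original \<phi> and enters the minimaxity condition,
  whereas \<open>M\<close> bounds \<psi>, that is the regularised \<phi>(w)/w, and serves
  integrability alone. The condition \<open>two\<close> keeps the numerator of W positive when one
  coordinate of x passes through 0.\<close>

locale shrinkage_model = elliptical g "(\<theta>, 0)" l + shrinkage_function \<psi> \<psi>' K M
  for g :: "real \<Rightarrow> ennreal" and \<theta> :: "real ^ 'p" and l :: "('p, 'n::finite) sample \<Rightarrow> real"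
    and \<psi> \<psi>' :: "real \<Rightarrow> real" and K M :: real +
  fixes c d v :: "real ^ 'p" and \<alpha> :: real
  assumes l_fst: "\<And>i. l (axis i 1, 0) = d $ i" and l_snd: "\<And>k. l (0, axis k 1) = 1"
    and c_pos: "\<And>i. c $ i > 0" and d_pos: "\<And>i. d $ i > 0" and v_nonneg: "\<And>i. v $ i \<ge> 0"
    and finite_P: "finite_measure P"
    and x_square_integrable: "\<And>i. integrable P (\<lambda>w. (fst w $ i)\<^sup>2)"
    and two: "\<And>i :: 'p. \<exists>k. k \<noteq> i"
    and \<psi>_measurable [measurable]: "\<psi> \<in> borel_measurable borel"
    and \<alpha>_pos: "\<alpha> > 0" and \<alpha>: "\<And>i. v $ i * d $ i / c $ i \<le> \<alpha>"
    and K_le: "(real CARD('n) + 2) * K \<le> 2 * ((\<Sum>i\<in>UNIV. v $ i * d $ i / c $ i) / \<alpha> - 2)"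
begin

sublocale P: finite_measure P by (rule finite_P)

definition y :: "'p \<Rightarrow> ('p, 'n) sample \<Rightarrow> real" where
  "y i w = (fst w $ i)\<^sup>2 / (c $ i * d $ i)"
definition Y :: "('p, 'n) sample \<Rightarrow> real" where
  "Y w = (\<Sum>i\<in>UNIV. y i w)"
definition S :: "('p, 'n) sample \<Rightarrow> real" where
  "S w = (\<Sum>k\<in>UNIV. (snd w $ k)\<^sup>2)"
definition \<Psi> :: "('p, 'n) sample \<Rightarrow> real" where
  "\<Psi> w = \<psi> (Y w / S w)"
text \<open>An average of the coefficients v_i d_i / c_i, with weights y_i / Y; it is 0 when Y is
  0.\<close>

definition A :: "('p, 'n) sample \<Rightarrow> real" where
  "A w = (\<Sum>i\<in>UNIV. v $ i * d $ i / c $ i * (y i w / Y w))"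
text \<open>Scaled so that \<open>S w * (A w * B w)\<close> is the quadratic term of the loss.
  Writing S as the sum of the squares z_k^2 then supplies the factor z_k that Stein's inequality
  consumes.\<close>

definition B :: "('p, 'n) sample \<Rightarrow> real" where
  "B w = (\<Psi> w)\<^sup>2 * (Y w / S w)"

section \<open>Measurability and pointwise bounds\<close>

lemma measurable_defs [measurable]:
  "y i \<in> borel_measurable borel" "Y \<in> borel_measurable borel" "S \<in> borel_measurable borel"
  "\<Psi> \<in> borel_measurable borel" "A \<in> borel_measurable borel" "B \<in> borel_measurable borel"
proof -
  show [measurable]: "y i \<in> borel_measurable borel" for i unfolding y_def[abs_def] by measurable
  show [measurable]: "Y \<in> borel_measurable borel" unfolding Y_def[abs_def] by measurable
  show [measurable]: "S \<in> borel_measurable borel" unfolding S_def[abs_def] by measurable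
  show [measurable]: "\<Psi> \<in> borel_measurable borel" unfolding \<Psi>_def[abs_def] by measurable
  show "A \<in> borel_measurable borel" unfolding A_def[abs_def] by measurable
  show "B \<in> borel_measurable borel" unfolding B_def[abs_def] by measurable
qed

lemma y_nonneg: "0 \<le> y i w"
  using c_pos[of i] d_pos[of i] by (simp add: y_def)

lemma Y_nonneg: "0 \<le> Y w" and S_nonneg: "0 \<le> S w"
  by (simp_all add: Y_def S_def sum_nonneg y_nonneg)

lemma W_nonneg: "0 \<le> Y w / S w"
  using Y_nonneg S_nonneg by simp

lemma y_fraction: "0 \<le> y i w / Y w" "y i w / Y w \<le> 1"
proof -
  show "0 \<le> y i w / Y w" using y_nonneg Y_nonneg by simp
  have "y i w \<le> Y w"
    unfolding Y_def by (rule member_le_sum) (auto simp: y_nonneg)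
  then show "y i w / Y w \<le> 1" by (rule real_fraction_le_one[OF y_nonneg])
qed

lemma z_fraction: "0 \<le> (snd w $ k)\<^sup>2 / S w" "(snd w $ k)\<^sup>2 / S w \<le> 1"
proof -
  show "0 \<le> (snd w $ k)\<^sup>2 / S w" using S_nonneg by simp
  have "(snd w $ k)\<^sup>2 \<le> S w"
    unfolding S_def by (rule member_le_sum) auto
  then show "(snd w $ k)\<^sup>2 / S w \<le> 1" by (rule real_fraction_le_one[OF zero_le_power2])
qed

lemma \<Psi>_nonneg: "0 \<le> \<Psi> w" and \<Psi>_le: "\<Psi> w \<le> M"
  using nonneg le W_nonneg by (simp_all add: \<Psi>_def)

lemma a_nonneg: "0 \<le> v $ i * d $ i / c $ i"
  using c_pos[of i] d_pos[of i] v_nonneg[of i] by simp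

lemma A_nonneg: "0 \<le> A w"
  unfolding A_def by (intro sum_nonneg mult_nonneg_nonneg a_nonneg y_fraction)

lemma A_le: "A w \<le> \<alpha>"
proof -
  have "A w \<le> (\<Sum>i\<in>UNIV. \<alpha> * (y i w / Y w))"
    unfolding A_def by (intro sum_mono mult_right_mono \<alpha> y_fraction)
  also have "\<dots> = \<alpha> * (Y w / Y w)"
    by (simp only: Y_def[of w, symmetric] sum_distrib_left[symmetric] sum_divide_distrib[symmetric])
  also have "\<dots> \<le> \<alpha>" using \<alpha>_pos by simp
  finally show ?thesis .
qed

lemma B_nonneg: "0 \<le> B w"
  unfolding B_def by (intro mult_nonneg_nonneg W_nonneg zero_le_power2)

text \<open>One factor \<Psi> is absorbed together with W into \<open>K\<close>. This makes the
  quadratic term linear in \<Psi>, hence comparable with the cross terms.\<close>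

lemma B_le: "B w \<le> K * \<Psi> w"
proof -
  have "B w = (\<Psi> w * (Y w / S w)) * \<Psi> w"
    by (simp add: B_def power2_eq_square)
  also have "\<dots> \<le> K * \<Psi> w"
    using mult_le[OF W_nonneg] \<Psi>_nonneg by (intro mult_right_mono) (auto simp: \<Psi>_def)
  finally show ?thesis .
qed

lemma B_le': "B w \<le> K * M"
  using B_le \<Psi>_le K_nonneg mult_left_mono order_trans by blast

lemma basis_fst: "(axis i 1, 0) \<in> (Basis :: ('p, 'n) sample set)"
  and basis_snd: "(0, axis k 1) \<in> (Basis :: ('p, 'n) sample set)"
  by (auto simp: Basis_prod_def axis_in_Basis_iff)

lemma coord_fst: "coord (axis i 1, 0) w = fst w $ i - \<theta> $ i"
  and coord_snd: "coord (0, axis k 1) w = snd w $ k"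
  by (simp_all add: coord_def inner_prod_def inner_axis)

lemma coord_fst_integrable: "integrable P (\<lambda>w. (fst w $ i - \<theta> $ i)\<^sup>2)"
proof (rule Bochner_Integration.integrable_bound)
  show "integrable P (\<lambda>w. 2 * (fst w $ i)\<^sup>2 + 2 * (\<theta> $ i)\<^sup>2)"
    using x_square_integrable by simp
  have "(a - b)\<^sup>2 \<le> 2 * a\<^sup>2 + 2 * b\<^sup>2" for a b :: real
    using zero_le_power2[of "a + b"] by (simp add: power2_eq_square algebra_simps)
  then show "AE w in P. norm ((fst w $ i - \<theta> $ i)\<^sup>2) \<le> norm (2 * (fst w $ i)\<^sup>2 + 2 * (\<theta> $ i)\<^sup>2)"
    by simp
qed simp

lemma finite_N: "finite_measure N"
  by (rule finite_measure_N[OF basis_fst[of undefined]]) (simp add: coord_fst coord_fst_integrable)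

sublocale N: finite_measure N by (rule finite_N)

text \<open>Finite second moments are assumed for x only. They make \<open>N\<close> finite, and the
  mass of \<open>N\<close> is the second moment of each coordinate of z.\<close>

lemma coord_snd_integrable: "integrable P (\<lambda>w. (snd w $ k)\<^sup>2)"
proof (rule integrableI_nonneg)
  show "(\<integral>\<^sup>+w. ennreal ((snd w $ k)\<^sup>2) \<partial>P) < \<infinity>"
    using nn_integral_coord_square[OF basis_snd[of k]]
    by (simp add: coord_snd l_snd less_top[symmetric])
qed simp_all

text \<open>Off this null set, moving a single coordinate leaves the remaining nonzero coordinates
  in place, as the two line lemmas require.\<close>

lemma AE_nonzero: "AE w in lborel. \<forall>b\<in>Basis. (w :: ('p, 'n) sample) \<bullet> b \<noteq> 0"
  by (intro AE_finite_allI finite_Basis AE_lborel_inner_neq)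

section \<open>Cross terms, along the coordinates of x\<close>

lemma numerator_integrable: "integrable P (\<lambda>w. (fst w $ i - \<theta> $ i) * (fst w $ i * \<Psi> w))"
proof (rule Bochner_Integration.integrable_bound)
  show "integrable P (\<lambda>w. M * ((fst w $ i - \<theta> $ i)\<^sup>2 + (fst w $ i)\<^sup>2))"
    using coord_fst_integrable x_square_integrable by simp
  have "\<bar>a * b\<bar> \<le> a\<^sup>2 + b\<^sup>2" for a b :: real
  proof -
    have "2 * (\<bar>a\<bar> * \<bar>b\<bar>) \<le> a\<^sup>2 + b\<^sup>2"
      using sum_squares_bound[of "\<bar>a\<bar>" "\<bar>b\<bar>"] by simp
    moreover have "0 \<le> \<bar>a\<bar> * \<bar>b\<bar>" by simp
    ultimately show ?thesis unfolding abs_mult by linarith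
  qed
  then have "\<bar>\<Psi> w\<bar> * \<bar>(fst w $ i - \<theta> $ i) * fst w $ i\<bar> \<le> M * ((fst w $ i - \<theta> $ i)\<^sup>2 + (fst w $ i)\<^sup>2)" for w
    using \<Psi>_nonneg[of w] \<Psi>_le[of w] M_nonneg by (intro mult_mono) auto
  then show "AE w in P. norm ((fst w $ i - \<theta> $ i) * (fst w $ i * \<Psi> w))
      \<le> norm (M * ((fst w $ i - \<theta> $ i)\<^sup>2 + (fst w $ i)\<^sup>2))"
    using M_nonneg by (simp add: abs_mult ac_simps)
qed simp

lemma numerator_inequality:
  "d $ i * (\<integral>w. \<Psi> w * (1 - 2 * (y i w / Y w)) \<partial>N)
    \<le> (\<integral>w. (fst w $ i - \<theta> $ i) * (fst w $ i * \<Psi> w) \<partial>P)"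
proof -
  let ?b = "(axis i 1, 0) :: ('p, 'n) sample"
  have "l ?b * (\<integral>w. \<Psi> w * (1 - 2 * (y i w / Y w)) \<partial>N) \<le> (\<integral>w. coord ?b w * (fst w $ i * \<Psi> w) \<partial>P)"
  proof (rule stein_inequality[OF basis_fst, where M = M])
    show "\<bar>\<Psi> w * (1 - 2 * (y i w / Y w))\<bar> \<le> M" for w
    proof -
      have "\<bar>\<Psi> w\<bar> * \<bar>1 - 2 * (y i w / Y w)\<bar> \<le> M * 1"
        using \<Psi>_nonneg[of w] \<Psi>_le[of w] y_fraction[of i w] M_nonneg by (intro mult_mono) auto
      then show ?thesis by (simp add: abs_mult)
    qed
    show "AE w in lborel. \<forall>t>0. \<exists>I. ((\<lambda>s. \<Psi> (w - s *\<^sub>R ?b) *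
        (1 - 2 * (y i (w - s *\<^sub>R ?b) / Y (w - s *\<^sub>R ?b)))) has_integral I) {0..t}
      \<and> I \<le> fst w $ i * \<Psi> w - fst (w - t *\<^sub>R ?b) $ i * \<Psi> (w - t *\<^sub>R ?b)"
      using AE_nonzero
    proof eventually_elim
      case (elim w)
      have x: "fst w $ k \<noteq> 0" for k
        using elim basis_fst[of k] by (auto simp: inner_prod_def inner_axis)
      have z: "snd w $ k \<noteq> 0" for k
        using elim basis_snd[of k] by (auto simp: inner_prod_def inner_axis)
      define r where "r = (\<Sum>k\<in>UNIV - {i}. y k w)"
      define e where "e = 1 / (c $ i * d $ i)"
      have e: "e \<ge> 0" using c_pos[of i] d_pos[of i] by (simp add: e_def)
      have y_eq: "y i (w - s *\<^sub>R ?b) = e * (fst w $ i - s)\<^sup>2" for s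
        by (simp add: y_def e_def)
      have Y_eq: "Y (w - s *\<^sub>R ?b) = r + e * (fst w $ i - s)\<^sup>2" for s
      proof -
        have "Y (w - s *\<^sub>R ?b) = y i (w - s *\<^sub>R ?b) + (\<Sum>k\<in>UNIV - {i}. y k (w - s *\<^sub>R ?b))"
          unfolding Y_def by (rule sum.remove) auto
        also have "(\<Sum>k\<in>UNIV - {i}. y k (w - s *\<^sub>R ?b)) = r"
          unfolding r_def by (rule sum.cong) (auto simp: y_def axis_def)
        finally show ?thesis by (simp only: y_eq add.commute)
      qed
      have Y_eq': "Y w = r + e * (fst w $ i)\<^sup>2"
        using Y_eq[of 0] by (simp only: scale_zero_left diff_0_right)
      have S_eq: "S (w - s *\<^sub>R ?b) = S w" for s by (simp add: S_def)
      have "S w > 0"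
        unfolding S_def using z by (intro sum_pos) auto
      moreover have "r > 0"
        unfolding r_def
      proof (rule sum_pos)
        show "UNIV - {i} \<noteq> {}" using two[of i] by blast
        show "0 < y k w" for k using x[of k] c_pos[of k] d_pos[of k] by (simp add: y_def)
      qed simp
      ultimately have line: "t \<ge> 0 \<Longrightarrow> \<exists>I. ((\<lambda>s. \<psi> ((r + e * (fst w $ i - s)\<^sup>2) / S w) *
          (1 - 2 * (e * (fst w $ i - s)\<^sup>2 / (r + e * (fst w $ i - s)\<^sup>2)))) has_integral I) {0..t}
        \<and> I \<le> fst w $ i * \<psi> ((r + e * (fst w $ i)\<^sup>2) / S w)
          - (fst w $ i - t) * \<psi> ((r + e * (fst w $ i - t)\<^sup>2) / S w)" for t
        using e by (intro numerator_line) auto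
      show ?case
        unfolding \<Psi>_def y_eq Y_eq S_eq Y_eq'
        using line by simp
    qed
  qed (simp_all add: coord_fst coord_fst_integrable numerator_integrable)
  then show ?thesis by (simp add: l_fst coord_fst)
qed

section \<open>Quadratic term, along the coordinates of z\<close>

lemma denominator_integrable: "integrable P (\<lambda>w. (snd w $ k)\<^sup>2 * (A w * B w))"
proof (rule Bochner_Integration.integrable_bound)
  show "integrable P (\<lambda>w. (\<alpha> * (K * M)) * (snd w $ k)\<^sup>2)"
    using coord_snd_integrable by simp
  have "A w * B w \<le> \<alpha> * (K * M)" for w
    using A_nonneg A_le B_nonneg B_le' \<alpha>_pos by (intro mult_mono) auto
  then have "(A w * B w) * (snd w $ k)\<^sup>2 \<le> (\<alpha> * (K * M)) * (snd w $ k)\<^sup>2" for w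
    by (rule mult_right_mono) simp
  then show "AE w in P. norm ((snd w $ k)\<^sup>2 * (A w * B w)) \<le> norm ((\<alpha> * (K * M)) * (snd w $ k)\<^sup>2)"
    using \<alpha>_pos K_nonneg M_nonneg A_nonneg B_nonneg by (simp add: mult.commute abs_mult)
qed simp

lemma AB_bound: "\<bar>A w * B w * (1 + 2 * ((snd w $ k)\<^sup>2 / S w))\<bar> \<le> \<alpha> * (K * M) * 3"
proof -
  have "A w * B w \<le> \<alpha> * (K * M)"
    using A_nonneg A_le B_nonneg B_le' \<alpha>_pos by (intro mult_mono) auto
  then have "A w * B w * (1 + 2 * ((snd w $ k)\<^sup>2 / S w)) \<le> \<alpha> * (K * M) * 3"
    by (rule mult_mono) (use z_fraction[of w k] \<alpha>_pos K_nonneg M_nonneg in auto)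
  moreover have "0 \<le> A w * B w * (1 + 2 * ((snd w $ k)\<^sup>2 / S w))"
    using z_fraction[of w k] A_nonneg B_nonneg by (intro mult_nonneg_nonneg add_nonneg_nonneg) auto
  ultimately show ?thesis by simp
qed

text \<open>An upper bound is wanted here, so Stein's inequality is applied to the negative of z_k A
  B. \<open>A\<close> depends on x alone and is therefore a nonnegative constant along lines in
  z.\<close>

lemma denominator_inequality:
  "(\<integral>w. (snd w $ k)\<^sup>2 * (A w * B w) \<partial>P) \<le> (\<integral>w. A w * B w * (1 + 2 * ((snd w $ k)\<^sup>2 / S w)) \<partial>N)"
proof -
  let ?b = "(0, axis k 1) :: ('p, 'n) sample"
  define k' where "k' w = - (A w * B w * (1 + 2 * ((snd w $ k)\<^sup>2 / S w)))" for w
  define h where "h w = - (A w * (snd w $ k * B w))" for w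
  have "l ?b * (\<integral>w. k' w \<partial>N) \<le> (\<integral>w. coord ?b w * h w \<partial>P)"
  proof (rule stein_inequality[OF basis_snd, where M = "\<alpha> * (K * M) * 3"])
    show "\<bar>k' w\<bar> \<le> \<alpha> * (K * M) * 3" for w
      using AB_bound by (simp add: k'_def)
    show "integrable P (\<lambda>w. coord ?b w * h w)"
      using denominator_integrable[of k]
      by (simp add: coord_snd h_def power2_eq_square ac_simps)
    show "AE w in lborel. \<forall>t>0. \<exists>I. ((\<lambda>s. k' (w - s *\<^sub>R ?b)) has_integral I) {0..t}
      \<and> I \<le> h w - h (w - t *\<^sub>R ?b)"
      using AE_nonzero
    proof eventually_elim
      case (elim w)
      have x: "fst w $ k \<noteq> 0" for k
        using elim basis_fst[of k] by (auto simp: inner_prod_def inner_axis)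
      define r where "r = (\<Sum>m\<in>UNIV - {k}. (snd w $ m)\<^sup>2)"
      have r: "r \<ge> 0" by (simp add: r_def sum_nonneg)
      have S_eq: "S (w - s *\<^sub>R ?b) = r + (snd w $ k - s)\<^sup>2" for s
      proof -
        have "S (w - s *\<^sub>R ?b) = (snd (w - s *\<^sub>R ?b) $ k)\<^sup>2 + (\<Sum>m\<in>UNIV - {k}. (snd (w - s *\<^sub>R ?b) $ m)\<^sup>2)"
          unfolding S_def by (rule sum.remove) auto
        also have "(\<Sum>m\<in>UNIV - {k}. (snd (w - s *\<^sub>R ?b) $ m)\<^sup>2) = r"
          unfolding r_def by (rule sum.cong) (auto simp: axis_def)
        finally show ?thesis by simp
      qed
      have y_eq: "y i (w - s *\<^sub>R ?b) = y i w" for i s by (simp add: y_def)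
      then have Y_eq: "Y (w - s *\<^sub>R ?b) = Y w" and A_eq: "A (w - s *\<^sub>R ?b) = A w" for s
        by (simp_all add: Y_def A_def)
      have Y: "Y w > 0"
        unfolding Y_def using x c_pos d_pos by (intro sum_pos) (auto simp: y_def)
      define B' where "B' x = (\<psi> (Y w / (r + x\<^sup>2)))\<^sup>2 * (Y w / (r + x\<^sup>2))" for x
      have B_eq: "B (w - s *\<^sub>R ?b) = B' (snd w $ k - s)" for s
        by (simp only: B_def \<Psi>_def Y_eq S_eq B'_def)
      have B_eq': "B w = B' (snd w $ k)"
        using B_eq[of 0] by (simp only: scale_zero_left diff_0_right)
      show ?case
      proof (intro allI impI)
        fix t :: real assume "t > 0"
        then obtain I where I: "((\<lambda>s. - (B' (snd w $ k - s) *
            (1 + 2 * ((snd w $ k - s)\<^sup>2 / (r + (snd w $ k - s)\<^sup>2))))) has_integral I) {0..t}"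
          "I \<le> - (snd w $ k * B' (snd w $ k)) - - ((snd w $ k - t) * B' (snd w $ k - t))"
          using denominator_line[OF r Y, of t "snd w $ k"] unfolding B'_def by auto
        have "((\<lambda>s. k' (w - s *\<^sub>R ?b)) has_integral A w * I) {0..t}"
          unfolding k'_def A_eq B_eq S_eq
          using has_integral_mult_right[OF I(1), of "A w"] by (simp add: ac_simps)
        moreover have "A w * I \<le> h w - h (w - t *\<^sub>R ?b)"
          unfolding h_def A_eq B_eq B_eq'
          using mult_left_mono[OF I(2) A_nonneg[of w]] by (simp add: algebra_simps)
        ultimately show "\<exists>I. ((\<lambda>s. k' (w - s *\<^sub>R ?b)) has_integral I) {0..t}
          \<and> I \<le> h w - h (w - t *\<^sub>R ?b)" by blast
      qed
    qed
  qed (simp_all add: coord_snd coord_snd_integrable k'_def[abs_def])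
  then show ?thesis
    by (simp add: l_snd coord_snd k'_def h_def power2_eq_square ac_simps)
qed

text \<open>Summing 1 + 2 z_k^2/S over k gives n + 2 (or n when S = 0), and summing (v_i d_i /
  c_i)(1 - 2 y_i/Y) over i gives T - 2A. \<open>B_le\<close> and \<open>K_le\<close> reduce the rest
  to A \<le> \<alpha>.\<close>

lemma integrand_nonpos:
  "- 2 * (\<Sum>i\<in>UNIV. v $ i * d $ i / c $ i * (\<Psi> w * (1 - 2 * (y i w / Y w))))
    + (\<Sum>k\<in>UNIV. A w * B w * (1 + 2 * ((snd w $ k)\<^sup>2 / S w))) \<le> 0"
proof -
  define T where "T = (\<Sum>i\<in>UNIV. v $ i * d $ i / c $ i)"
  have T: "T \<ge> 0" unfolding T_def by (intro sum_nonneg a_nonneg)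
  have 1: "(\<Sum>i\<in>UNIV. v $ i * d $ i / c $ i * (\<Psi> w * (1 - 2 * (y i w / Y w)))) = \<Psi> w * (T - 2 * A w)"
    by (simp add: T_def A_def sum_distrib_left sum_subtractf algebra_simps)
  have "(\<Sum>k\<in>UNIV. A w * B w * (1 + 2 * ((snd w $ k)\<^sup>2 / S w)))
      = A w * B w * ((\<Sum>k\<in>(UNIV :: 'n set). 1) + 2 * (S w / S w))"
    by (simp only: sum.distrib S_def[of w, symmetric] sum_divide_distrib[symmetric]
      sum_distrib_left[symmetric])
  also have "\<dots> \<le> A w * B w * (real CARD('n) + 2)"
    using A_nonneg B_nonneg by (intro mult_left_mono) auto
  also have "\<dots> \<le> A w * (K * \<Psi> w) * (real CARD('n) + 2)"
    using A_nonneg B_le by (intro mult_right_mono mult_left_mono) auto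
  also have "\<dots> = A w * \<Psi> w * ((real CARD('n) + 2) * K)"
    by simp
  also have "\<dots> \<le> A w * \<Psi> w * (2 * (T / \<alpha> - 2))"
    unfolding T_def using A_nonneg \<Psi>_nonneg K_le by (intro mult_left_mono) auto
  finally have 2: "(\<Sum>k\<in>UNIV. A w * B w * (1 + 2 * ((snd w $ k)\<^sup>2 / S w)))
    \<le> A w * \<Psi> w * (2 * (T / \<alpha> - 2))" .
  \<comment> \<open>The terms 4 A \<Psi> from the two sums cancel exactly, so A \<le> \<alpha> is
    needed only in the term containing T.\<close>
  have "A w * (\<Psi> w * (T / \<alpha>)) \<le> \<alpha> * (\<Psi> w * (T / \<alpha>))"
    using A_le \<Psi>_nonneg T \<alpha>_pos by (intro mult_right_mono) auto
  then have 3: "A w * (\<Psi> w * (T / \<alpha>)) \<le> \<Psi> w * T"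
    using \<alpha>_pos by simp
  note add_left_mono[OF 2, of "- 2 * (\<Psi> w * (T - 2 * A w))"]
  also have "- 2 * (\<Psi> w * (T - 2 * A w)) + A w * \<Psi> w * (2 * (T / \<alpha> - 2))
      = 2 * (A w * (\<Psi> w * (T / \<alpha>)) - \<Psi> w * T)"
    by (simp add: algebra_simps)
  also have "2 * (A w * (\<Psi> w * (T / \<alpha>)) - \<Psi> w * T) \<le> 0"
    using 3 by simp
  finally show ?thesis unfolding 1 .
qed

section \<open>Assembly of the risk difference\<close>

lemma loss_expansion:
  "(\<Sum>i\<in>UNIV. v $ i * ((1 - \<Psi> w / c $ i) * fst w $ i - \<theta> $ i)\<^sup>2) =
    (\<Sum>i\<in>UNIV. v $ i * (fst w $ i - \<theta> $ i)\<^sup>2)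
    + (- 2 * (\<Sum>i\<in>UNIV. v $ i / c $ i * ((fst w $ i - \<theta> $ i) * (fst w $ i * \<Psi> w)))
    + (\<Sum>k\<in>UNIV. (snd w $ k)\<^sup>2 * (A w * B w)))"
proof -
  have "(\<Sum>i\<in>UNIV. v $ i * ((\<Psi> w / c $ i) * fst w $ i)\<^sup>2) = S w * (A w * B w)"
  proof (cases "Y w = 0 \<or> S w = 0")
    \<comment> \<open>In both degenerate cases the quotient Y/S is 0, where \<psi> vanishes, so both
      sides are 0.\<close>
    case True
    then have "\<Psi> w = 0" using zero by (auto simp: \<Psi>_def)
    then show ?thesis by (simp add: B_def)
  next
    case False
    have "(\<Sum>i\<in>UNIV. v $ i * ((\<Psi> w / c $ i) * fst w $ i)\<^sup>2)
        = (\<Sum>i\<in>UNIV. (\<Psi> w)\<^sup>2 * Y w * (v $ i * d $ i / c $ i * (y i w / Y w)))"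
      using False c_pos d_pos
      by (intro sum.cong) (auto simp: y_def power2_eq_square less_imp_neq[THEN not_sym])
    also have "\<dots> = (\<Psi> w)\<^sup>2 * Y w * A w"
      by (simp add: A_def sum_distrib_left)
    also have "\<dots> = S w * (A w * B w)"
      using False by (simp add: B_def)
    finally show ?thesis .
  qed
  moreover have "v $ i * ((1 - \<Psi> w / c $ i) * fst w $ i - \<theta> $ i)\<^sup>2 = v $ i * (fst w $ i - \<theta> $ i)\<^sup>2
      + (- 2 * (v $ i / c $ i * ((fst w $ i - \<theta> $ i) * (fst w $ i * \<Psi> w)))
      + v $ i * ((\<Psi> w / c $ i) * fst w $ i)\<^sup>2)" for i
    by (simp add: power2_eq_square algebra_simps)
  ultimately show ?thesis
    by (simp add: sum.distrib sum_subtractf sum_negf S_def sum_distrib_left sum_distrib_right)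
qed

lemma expected_loss_le:
  "(\<integral>\<^sup>+w. ennreal (\<Sum>i\<in>UNIV. v $ i * ((1 - \<Psi> w / c $ i) * fst w $ i - \<theta> $ i)\<^sup>2) \<partial>P)
    \<le> (\<integral>\<^sup>+w. ennreal (\<Sum>i\<in>UNIV. v $ i * (fst w $ i - \<theta> $ i)\<^sup>2) \<partial>P)"
proof -
  define L where "L w = (\<Sum>i\<in>UNIV. v $ i * (fst w $ i - \<theta> $ i)\<^sup>2)" for w :: "('p, 'n) sample"
  define D where "D w = - 2 * (\<Sum>i\<in>UNIV. v $ i / c $ i * ((fst w $ i - \<theta> $ i) * (fst w $ i * \<Psi> w)))
    + (\<Sum>k\<in>UNIV. (snd w $ k)\<^sup>2 * (A w * B w))" for w
  have L: "integrable P L"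
    unfolding L_def using coord_fst_integrable by simp
  have D: "integrable P D"
    unfolding D_def using numerator_integrable denominator_integrable by simp
  have N1: "integrable N (\<lambda>w. \<Psi> w * (1 - 2 * (y i w / Y w)))" for i
  proof (rule N.integrable_const_bound[of _ M])
    have "\<bar>\<Psi> w\<bar> * \<bar>1 - 2 * (y i w / Y w)\<bar> \<le> M * 1" for w
      using \<Psi>_nonneg[of w] \<Psi>_le[of w] y_fraction[of i w] M_nonneg by (intro mult_mono) auto
    then show "AE w in N. norm (\<Psi> w * (1 - 2 * (y i w / Y w))) \<le> M"
      by (simp add: abs_mult)
  qed simp
  have N2: "integrable N (\<lambda>w. A w * B w * (1 + 2 * ((snd w $ k)\<^sup>2 / S w)))" for k
    by (rule N.integrable_const_bound[of _ "\<alpha> * (K * M) * 3"]) (simp_all only: real_norm_def AB_bound, auto)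
  have "(\<integral>w. D w \<partial>P) = - 2 * (\<Sum>i\<in>UNIV. v $ i / c $ i * (\<integral>w. (fst w $ i - \<theta> $ i) * (fst w $ i * \<Psi> w) \<partial>P))
      + (\<Sum>k\<in>UNIV. \<integral>w. (snd w $ k)\<^sup>2 * (A w * B w) \<partial>P)"
    unfolding D_def using numerator_integrable denominator_integrable by simp
  \<comment> \<open>The factor -2 turns the lower bounds for the cross terms into upper bounds; the
    quadratic terms are bounded above directly.\<close>
  also have "\<dots> \<le> - 2 * (\<Sum>i\<in>UNIV. v $ i / c $ i * (d $ i * (\<integral>w. \<Psi> w * (1 - 2 * (y i w / Y w)) \<partial>N)))
      + (\<Sum>k\<in>UNIV. \<integral>w. A w * B w * (1 + 2 * ((snd w $ k)\<^sup>2 / S w)) \<partial>N)"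
    using v_nonneg c_pos numerator_inequality denominator_inequality
    by (intro add_mono sum_mono mult_left_mono_neg mult_left_mono) (auto simp: less_imp_le)
  also have "\<dots> = (\<integral>w. - 2 * (\<Sum>i\<in>UNIV. v $ i * d $ i / c $ i * (\<Psi> w * (1 - 2 * (y i w / Y w))))
      + (\<Sum>k\<in>UNIV. A w * B w * (1 + 2 * ((snd w $ k)\<^sup>2 / S w))) \<partial>N)"
    using N1 N2 by (simp add: ac_simps)
  also have "\<dots> \<le> 0"
    (is "integral\<^sup>L N ?R \<le> 0")
  proof -
    have "0 \<le> (\<integral>w. - ?R w \<partial>N)"
      using integrand_nonpos by (intro Bochner_Integration.integral_nonneg) (simp only: neg_0_le_iff_le)
    then show ?thesis by (simp only: Bochner_Integration.integral_minus neg_0_le_iff_le)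
  qed
  finally have "(\<integral>w. L w + D w \<partial>P) \<le> (\<integral>w. L w \<partial>P)"
    using L D by simp
  moreover have "(\<integral>\<^sup>+w. ennreal (L w + D w) \<partial>P) = ennreal (\<integral>w. L w + D w \<partial>P)"
  proof (rule nn_integral_eq_integral)
    have "0 \<le> L w + D w" for w
      unfolding L_def D_def loss_expansion[symmetric] using v_nonneg by (simp add: sum_nonneg)
    then show "AE w in P. 0 \<le> L w + D w" by simp
  qed (use L D in simp)
  moreover have "(\<integral>\<^sup>+w. ennreal (L w) \<partial>P) = ennreal (\<integral>w. L w \<partial>P)"
    using v_nonneg by (intro nn_integral_eq_integral L) (simp add: L_def sum_nonneg)
  ultimately have "(\<integral>\<^sup>+w. ennreal (L w + D w) \<partial>P) \<le> (\<integral>\<^sup>+w. ennreal (L w) \<partial>P)"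
    by (simp add: ennreal_leI)
  then show ?thesis
    unfolding loss_expansion L_def D_def .
qed

end

section \<open>The model in coordinates\<close>

lemma diag_matrix_vector_mult: "diag_matrix v *v x = (\<chi> i. v $ i * x $ i)"
  by (simp add: diag_matrix_def matrix_vector_mult_def vec_eq_iff if_distrib[of "\<lambda>a. a * _"]
      cong: if_cong)

lemma matrix_inv_diag_matrix:
  fixes v :: "real ^ 'p"
  assumes "\<And>i. v $ i \<noteq> 0"
  shows "matrix_inv (diag_matrix v) = diag_matrix (\<chi> i. 1 / v $ i)"
proof -
  have mult: "diag_matrix u ** diag_matrix u' = mat 1" if "\<And>i. u $ i * u' $ i = 1" for u u' :: "real ^ 'p"
    using that by (auto simp: diag_matrix_def matrix_matrix_mult_def mat_def vec_eq_iff
        if_distrib[of "\<lambda>a. a * _"] if_distrib[of "\<lambda>a. _ * a"] cong: if_cong)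
  let ?D = "diag_matrix v" and ?E = "diag_matrix (\<chi> i. 1 / v $ i)"
  have DE: "?D ** ?E = mat 1" "?E ** ?D = mat 1"
    using assms by (auto intro!: mult)
  have inv: "?D ** matrix_inv ?D = mat 1"
    unfolding matrix_inv_def by (rule someI2[of _ ?E]) (use DE in auto)
  have "matrix_inv ?D = (?E ** ?D) ** matrix_inv ?D" by (simp add: DE)
  also have "\<dots> = ?E" by (simp add: matrix_mul_assoc[symmetric] inv)
  finally show ?thesis .
qed

section \<open>Coordinate formulas for loss, statistic, estimator and density\<close>

lemma loss_eq: "loss j d a \<theta> s2 = (\<Sum>i\<in>UNIV. d $ i powr (- j) * (a $ i - \<theta> $ i)\<^sup>2) / s2"
  by (simp add: loss_def diag_matrix_vector_mult inner_vec_def power2_eq_square ac_simps)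

lemma W_stat_eq:
  fixes c d :: "real ^ 'p"
  assumes "\<And>i. c $ i > 0" "\<And>i. d $ i > 0"
  shows "W_stat c d w = (\<Sum>i\<in>UNIV. (fst w $ i)\<^sup>2 / (c $ i * d $ i)) / (\<Sum>k\<in>UNIV. (snd w $ k)\<^sup>2)"
proof -
  have "c $ i \<noteq> 0" "d $ i \<noteq> 0" for i using assms[of i] by auto
  then show ?thesis
    by (simp add: W_stat_def split_beta matrix_inv_diag_matrix diag_matrix_vector_mult inner_vec_def
      power2_eq_square flip: matrix_vector_mul_assoc)
qed

lemma shrinkage_estimator_nth:
  fixes c d :: "real ^ 'p"
  assumes "\<And>i. c $ i > 0"
  shows "shrinkage_estimator c d \<phi> w $ i = (1 - \<phi> (W_stat c d w) / W_stat c d w / c $ i) * fst w $ i"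
proof -
  have "c $ i \<noteq> 0" for i using assms[of i] by auto
  then show ?thesis
    by (cases w) (simp add: shrinkage_estimator_def matrix_inv_diag_matrix diag_matrix_vector_mult
      matrix_vector_mult_diff_rdistrib scaleR_matrix_vector_assoc[symmetric] algebra_simps)
qed

lemma sample_density_eq:
  fixes d \<theta> :: "real ^ 'p" and w :: "('p::finite, 'n::finite) sample"
  assumes "\<And>i. d $ i > 0"
  shows "sample_density f d \<theta> \<sigma> w =
    (\<Prod>i\<in>UNIV. d $ i powr (- 1 / 2)) * \<sigma> powi (- int CARD('p) - int CARD('n)) *
    f (((\<Sum>i\<in>UNIV. (fst w $ i - \<theta> $ i)\<^sup>2 / d $ i) + (\<Sum>k\<in>UNIV. (snd w $ k)\<^sup>2)) / \<sigma>\<^sup>2)"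
proof -
  have "d $ i \<noteq> 0" for i using assms[of i] by auto
  then show ?thesis
    by (simp add: sample_density_def split_beta matrix_inv_diag_matrix diag_matrix_vector_mult
      inner_vec_def power2_eq_square)
qed

lemma sum_Basis_vec:
  fixes G :: "real ^ 'm \<Rightarrow> real"
  shows "(\<Sum>b\<in>Basis. G b) = (\<Sum>i\<in>UNIV. G (axis i 1))"
proof -
  have eq: "Basis = range (\<lambda>i. axis i 1 :: real ^ 'm)" by (auto simp: Basis_vec_def)
  show ?thesis unfolding eq by (subst sum.reindex) (simp_all add: inj_on_def axis_eq_axis)
qed

lemma sum_Basis_sample:
  fixes F :: "('p::finite, 'n::finite) sample \<Rightarrow> real"
  shows "(\<Sum>b\<in>Basis. F b) = (\<Sum>i\<in>UNIV. F (axis i 1, 0)) + (\<Sum>k\<in>UNIV. F (0, axis k 1))"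
proof -
  have "(\<Sum>b\<in>Basis. F b) = (\<Sum>u\<in>Basis. F (u, 0)) + (\<Sum>v\<in>Basis. F (0, v))"
    unfolding Basis_prod_def
    by (subst sum.union_disjoint) (auto simp: sum.reindex inj_on_def)
  then show ?thesis by (simp add: sum_Basis_vec)
qed

text \<open>\<open>f\<close> is measurable on the nonnegative half-line; its extension by 0 is Borel
  and agrees with it at every argument occurring in the density.\<close>

lemma borel_measurable_sample_density:
  fixes d \<theta> :: "real ^ 'p"
  assumes "\<And>i. d $ i > 0" and f: "f \<in> borel_measurable (restrict_space borel {0..})"
  shows "(sample_density f d \<theta> \<sigma> :: ('p::finite, 'n::finite) sample \<Rightarrow> real) \<in> borel_measurable borel"
proof -
  have [measurable]: "(\<lambda>t. indicator {0..} t *\<^sub>R f t) \<in> borel_measurable borel"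
    using f by (simp add: borel_measurable_restrict_space_iff)
  define q where "q w = ((\<Sum>i\<in>UNIV. (fst w $ i - \<theta> $ i)\<^sup>2 / d $ i) + (\<Sum>k\<in>UNIV. (snd w $ k)\<^sup>2)) / \<sigma>\<^sup>2"
    for w :: "('p, 'n) sample"
  have [measurable]: "q \<in> borel_measurable borel"
    unfolding q_def[abs_def] by measurable
  have "0 \<le> q w" for w
    unfolding q_def using assms(1)
    by (intro divide_nonneg_nonneg add_nonneg_nonneg sum_nonneg) (auto simp: less_imp_le)
  then have eq: "sample_density f d \<theta> \<sigma> w = (\<Prod>i\<in>UNIV. d $ i powr (- 1 / 2)) *
      \<sigma> powi (- int CARD('p) - int CARD('n)) * (indicator {0..} (q w) *\<^sub>R f (q w))"
    for w :: "('p, 'n) sample"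
    unfolding sample_density_eq[OF assms(1)] by (simp add: q_def[symmetric])
  show ?thesis
    unfolding eq[abs_def]
    by (intro borel_measurable_times borel_measurable_const
      measurable_compose[OF \<open>q \<in> borel_measurable borel\<close>
        \<open>(\<lambda>t. indicator {0..} t *\<^sub>R f t) \<in> borel_measurable borel\<close>])
qed

text \<open>For fixed \<sigma> the density is a translate in x of the one at \<theta> = 0, which is
  even in x, and the loss depends only on the error. The location bound therefore applies, with the
  maximal risk over all \<theta> and \<sigma> as the bound on the risks at this \<sigma>.\<close>

lemma risk_identity_le_max_risk:
  fixes d \<theta> :: "real ^ 'p" and \<delta> :: "('p::finite, 'n::finite) sample \<Rightarrow> real ^ 'p"
  assumes d_pos: "\<And>i. d $ i > 0" and f: "f \<in> borel_measurable (restrict_space borel {0..})"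
    and \<delta> [measurable]: "\<delta> \<in> borel_measurable borel" and \<sigma>: "\<sigma> > 0"
  shows "risk f d j (fst :: ('p, 'n) sample \<Rightarrow> _) \<theta> \<sigma> \<le> max_risk f d j \<delta>"
proof -
  define p where "p w = ennreal (sample_density f d 0 \<sigma> w)" for w :: "('p, 'n) sample"
  define \<rho> where "\<rho> u = ennreal ((\<Sum>i\<in>UNIV. d $ i powr (- j) * (u $ i)\<^sup>2) / \<sigma>\<^sup>2)" for u :: "real ^ 'p"
  note [measurable] = borel_measurable_sample_density[OF d_pos f]
  have p [measurable]: "p \<in> borel_measurable borel" unfolding p_def[abs_def] by measurable
  have [measurable]: "(\<lambda>u :: real ^ 'p. u $ i) \<in> borel_measurable borel" for i
    by (intro borel_measurable_continuous_onI continuous_intros)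
  have \<rho> [measurable]: "\<rho> \<in> borel_measurable borel" unfolding \<rho>_def[abs_def] by measurable
  have [measurable]: "(fst :: ('p, 'n) sample \<Rightarrow> _) \<in> borel_measurable borel"
    "(snd :: ('p, 'n) sample \<Rightarrow> _) \<in> borel_measurable borel"
    by (intro borel_measurable_continuous_onI continuous_intros)+
  note [measurable (raw)] = measurable_compose[OF borel_measurable_Pair p]
  have risk: "risk f d j \<delta>' t \<sigma> = (\<integral>\<^sup>+w. p (fst w - t, snd w) * \<rho> (\<delta>' w - t) \<partial>lborel)"
    if [measurable]: "\<delta>' \<in> borel_measurable borel" for \<delta>' :: "('p, 'n) sample \<Rightarrow> real ^ 'p" and t
  proof -
    have \<rho>_eq: "ennreal (loss j d (\<delta>' w) t (\<sigma>\<^sup>2)) = \<rho> (\<delta>' w - t)" for w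
      by (simp add: loss_eq \<rho>_def)
    have p_eq: "ennreal (sample_density f d t \<sigma> w) = p (fst w - t, snd w)" for w
      by (simp add: p_def sample_density_eq[OF d_pos])
    show ?thesis
      unfolding risk_def sample_dist_def \<rho>_eq
      by (subst nn_integral_density) (simp_all add: p_eq)
  qed
  have "(\<integral>\<^sup>+w. p w * \<rho> (fst w) \<partial>lborel) \<le> max_risk f d j \<delta>"
  proof (rule location_risk_lower_bound[OF p \<rho> \<delta>])
    show "p (- u, z) = p (u, z)" for u z
      by (simp add: p_def sample_density_eq[OF d_pos])
    show "2 * \<rho> u \<le> \<rho> (u + a) + \<rho> (- u + a)" for a u
    proof -
      have nonneg: "0 \<le> (\<Sum>i\<in>UNIV. d $ i powr (- j) * (t $ i)\<^sup>2) / \<sigma>\<^sup>2" for t :: "real ^ 'p"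
        by (intro divide_nonneg_nonneg sum_nonneg) auto
      \<comment> \<open>This is the parallelogram law for the weighted quadratic form, with the term
        in \<open>a\<close> dropped.\<close>
      have "2 * (\<Sum>i\<in>UNIV. d $ i powr (- j) * (u $ i)\<^sup>2)
          \<le> 2 * (\<Sum>i\<in>UNIV. d $ i powr (- j) * (u $ i)\<^sup>2) + 2 * (\<Sum>i\<in>UNIV. d $ i powr (- j) * (a $ i)\<^sup>2)"
        by (simp add: sum_nonneg)
      also have "\<dots> = (\<Sum>i\<in>UNIV. d $ i powr (- j) * ((u + a) $ i)\<^sup>2) + (\<Sum>i\<in>UNIV. d $ i powr (- j) * ((- u + a) $ i)\<^sup>2)"
        unfolding sum_distrib_left sum.distrib[symmetric]
        by (rule sum.cong) (simp_all add: power2_eq_square algebra_simps)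
      finally have "2 * ((\<Sum>i\<in>UNIV. d $ i powr (- j) * (u $ i)\<^sup>2) / \<sigma>\<^sup>2)
        \<le> (\<Sum>i\<in>UNIV. d $ i powr (- j) * ((u + a) $ i)\<^sup>2) / \<sigma>\<^sup>2 + (\<Sum>i\<in>UNIV. d $ i powr (- j) * ((- u + a) $ i)\<^sup>2) / \<sigma>\<^sup>2"
        by (simp add: divide_right_mono flip: add_divide_distrib)
      then have "ennreal (2 * ((\<Sum>i\<in>UNIV. d $ i powr (- j) * (u $ i)\<^sup>2) / \<sigma>\<^sup>2)) \<le> \<rho> (u + a) + \<rho> (- u + a)"
        unfolding \<rho>_def ennreal_plus[OF nonneg nonneg, symmetric] by (rule ennreal_leI)
      then show ?thesis
        unfolding \<rho>_def by (simp add: ennreal_mult' del: times_divide_eq_right)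
    qed
    show "(\<integral>\<^sup>+w. p (fst w - t, snd w) * \<rho> (\<delta> w - t) \<partial>lborel) \<le> max_risk f d j \<delta>" for t
      unfolding risk[OF \<delta>, symmetric] max_risk_def
      using \<sigma> by (intro SUP_upper2[of "(t, \<sigma>)"]) auto
  qed
  moreover have "risk f d j (fst :: ('p, 'n) sample \<Rightarrow> _) \<theta> \<sigma> = (\<integral>\<^sup>+w. p w * \<rho> (fst w) \<partial>lborel)"
  proof -
    have "(\<integral>\<^sup>+w. p w * \<rho> (fst w) \<partial>lborel)
        = (\<integral>\<^sup>+w. p (w + (- \<theta>, 0)) * \<rho> (fst (w + (- \<theta>, 0))) \<partial>lborel)"
      by (rule nn_integral_lborel_translate[of "\<lambda>w. p w * \<rho> (fst w)", symmetric]) measurable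
    also have "\<dots> = (\<integral>\<^sup>+w. p (fst w - \<theta>, snd w) * \<rho> (fst w - \<theta>) \<partial>lborel)"
      by (rule nn_integral_cong) (simp add: plus_prod_def)
    finally show ?thesis using risk[of fst \<theta>] by simp
  qed
  ultimately show ?thesis by simp
qed

section \<open>Risk comparison and minimaxity\<close>

lemma risk_shrinkage_le_risk_identity:
  fixes f \<phi> :: "real \<Rightarrow> real" and c d \<theta> :: "real ^ 'p" and j \<sigma> :: real
  defines "a \<equiv> \<lambda>i. d $ i powr (1 - j) / c $ i"
  assumes d_pos: "\<And>i. d $ i > 0" and c_pos: "\<And>i. c $ i > 0" and \<sigma>: "\<sigma> > 0"
    and f: "f \<in> borel_measurable (restrict_space borel {0..})"
    and prob: "prob_space (sample_dist f d \<theta> \<sigma> :: ('p::finite, 'n::finite) sample measure)"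
    and moments: "\<And>i. integrable (sample_dist f d \<theta> \<sigma> :: ('p, 'n) sample measure) (\<lambda>(x, z). (x $ i)\<^sup>2)"
    and \<phi>_differentiable: "\<And>w. w > 0 \<Longrightarrow> \<phi> differentiable (at w)"
    and \<phi>_deriv_nonneg: "\<And>w. w > 0 \<Longrightarrow> deriv \<phi> w \<ge> 0"
    and \<phi>_bounds: "\<And>w. w > 0 \<Longrightarrow> 0 \<le> \<phi> w \<and>
      \<phi> w \<le> 2 / (real CARD('n) + 2) * ((\<Sum>i\<in>UNIV. a i) / (MAX i\<in>UNIV. a i) - 2)"
  shows "risk f d j (shrinkage_estimator c d \<phi> :: ('p, 'n) sample \<Rightarrow> _) \<theta> \<sigma> \<le> risk f d j (fst :: ('p, 'n) sample \<Rightarrow> _) \<theta> \<sigma>"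
    and "(shrinkage_estimator c d \<phi> :: ('p, 'n) sample \<Rightarrow> _) \<in> borel_measurable borel"
proof -
  define C where "C = (\<Prod>i\<in>UNIV. d $ i powr (- 1 / 2)) * \<sigma> powi (- int CARD('p) - int CARD('n))"
  define g where "g t = ennreal (C * (indicator {0..} (t / \<sigma>\<^sup>2) *\<^sub>R f (t / \<sigma>\<^sup>2)))" for t
  define l where "l b = (\<Sum>i\<in>UNIV. d $ i * (fst b $ i)\<^sup>2) + (\<Sum>k\<in>UNIV. (snd b $ k)\<^sup>2)"
    for b :: "('p, 'n) sample"
  define \<alpha> where "\<alpha> = (MAX i\<in>UNIV. a i)"
  define \<kappa> where "\<kappa> = 2 / (real CARD('n) + 2) * ((\<Sum>i\<in>UNIV. a i) / \<alpha> - 2)"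
  \<comment> \<open>The values of \<phi> outside (0, \<infinity>) are arbitrary, so they are
    replaced by 0. The estimator is unchanged: W is never negative, and at W = 0 both quotients are
    0.\<close>
  define \<phi>0 where "\<phi>0 w = indicator {0<..} w *\<^sub>R \<phi> w" for w :: real
  define W where "W = (W_stat c d :: ('p, 'n) sample \<Rightarrow> real)"

  have a_pos: "a i > 0" for i using d_pos[of i] c_pos[of i] by (simp add: a_def)
  have a_le: "a i \<le> \<alpha>" for i unfolding \<alpha>_def by (rule Max_ge) auto
  have \<alpha>: "\<alpha> > 0" using a_pos[of undefined] a_le[of undefined] by simp
  have \<phi>: "0 \<le> \<phi> w" "\<phi> w \<le> \<kappa>" if "w > 0" for w
    using \<phi>_bounds[OF that] by (auto simp: \<kappa>_def \<alpha>_def)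
  have \<kappa>: "\<kappa> \<ge> 0" using \<phi>[of 1] by simp
  \<comment> \<open>With a single index the sum equals the maximum, so the upper bound for \<phi>
    would be -2/(n + 2), below its lower bound 0.\<close>
  have two: "\<exists>k. k \<noteq> i" for i :: 'p
  proof (rule ccontr)
    assume "\<nexists>k. k \<noteq> i"
    then have univ: "(UNIV :: 'p set) = {i}" by auto
    have "\<kappa> = - 2 / (real CARD('n) + 2)"
      using a_pos[of i] by (simp add: \<kappa>_def \<alpha>_def univ)
    also have "\<dots> < 0" by (simp add: divide_neg_pos)
    finally show False using \<kappa> by simp
  qed
  have [measurable]: "(\<lambda>t. indicator {0..} t *\<^sub>R f t) \<in> borel_measurable borel"
    using f by (simp add: borel_measurable_restrict_space_iff)
  have g_measurable: "g \<in> borel_measurable borel"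
  proof -
    have "(\<lambda>t. indicator {0..} (t / \<sigma>\<^sup>2) *\<^sub>R f (t / \<sigma>\<^sup>2)) \<in> borel_measurable borel"
      by (rule measurable_compose[of "\<lambda>t. t / \<sigma>\<^sup>2" borel borel]) measurable
    then show ?thesis unfolding g_def[abs_def] by measurable
  qed
  have l_fst: "l (axis i 1, 0) = d $ i" for i
  proof -
    have "(\<Sum>k\<in>UNIV. d $ k * (axis i (1 :: real) $ k)\<^sup>2) = (\<Sum>k\<in>UNIV. if k = i then d $ k else 0)"
      by (rule sum.cong) (auto simp: axis_def)
    then show ?thesis by (simp add: l_def)
  qed
  have l_snd: "l (0, axis k 1) = 1" for k
  proof -
    have "(\<Sum>m\<in>UNIV. (axis k (1 :: real) $ m)\<^sup>2) = (\<Sum>m\<in>UNIV. if m = k then 1 else 0)"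
      by (rule sum.cong) (auto simp: axis_def)
    then show ?thesis by (simp add: l_def)
  qed
  interpret elliptical g "(\<theta>, 0 :: real ^ 'n)" l
  proof
    show "g \<in> borel_measurable borel" by (rule g_measurable)
    show "g t < \<infinity>" for t by (simp add: g_def)
    show "l b > 0" if "b \<in> Basis" for b
      using that d_pos l_fst l_snd by (auto simp: Basis_prod_def Basis_vec_def)
  qed
  have quad_eq: "quad w = (\<Sum>i\<in>UNIV. (fst w $ i - \<theta> $ i)\<^sup>2 / d $ i) + (\<Sum>k\<in>UNIV. (snd w $ k)\<^sup>2)" for w
    by (simp add: quad_def coord_def sum_Basis_sample l_fst l_snd inner_prod_def inner_axis)
  have P_eq: "P = sample_dist f d \<theta> \<sigma>"
  proof -
    have "0 \<le> quad w" for w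
      unfolding quad_def using l_pos by (intro sum_nonneg divide_nonneg_nonneg) (auto simp: less_imp_le)
    then have "g (quad w) = ennreal (sample_density f d \<theta> \<sigma> w)" for w
      unfolding sample_density_eq[OF d_pos] quad_eq[symmetric] by (simp add: g_def C_def)
    then show ?thesis by (simp add: P_def sample_dist_def)
  qed
  have W_eq: "W w = (\<Sum>i\<in>UNIV. (fst w $ i)\<^sup>2 / (c $ i * d $ i)) / (\<Sum>k\<in>UNIV. (snd w $ k)\<^sup>2)" for w
    unfolding W_def by (rule W_stat_eq[OF c_pos d_pos])
  have W_nonneg: "0 \<le> W w" for w
    unfolding W_eq using c_pos d_pos by (intro divide_nonneg_nonneg sum_nonneg) (auto simp: less_imp_le)
  have [measurable]: "W \<in> borel_measurable borel"
    unfolding W_eq[abs_def] by measurable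
  have [measurable]: "\<phi>0 \<in> borel_measurable borel"
    unfolding \<phi>0_def[abs_def]
  proof (rule borel_measurable_continuous_on_indicator)
    show "continuous_on {0<..} \<phi>"
      using \<phi>_differentiable
      by (intro continuous_at_imp_continuous_on ballI differentiable_imp_continuous_within) auto
  qed simp
  have \<phi>_W: "\<phi> (W w) / W w = \<phi>0 (W w) / W w" for w
    using W_nonneg[of w] by (cases "W w = 0") (auto simp: \<phi>0_def indicator_def)
  have estimator: "shrinkage_estimator c d \<phi> w $ i = (1 - \<phi>0 (W w) / W w / c $ i) * fst w $ i" for w i
    using shrinkage_estimator_nth[OF c_pos, of d \<phi> w i] by (simp add: W_def[symmetric] \<phi>_W)
  show "(shrinkage_estimator c d \<phi> :: ('p, 'n) sample \<Rightarrow> _) \<in> borel_measurable borel"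
    by (subst borel_measurable_euclidean_space)
      (auto simp: Basis_vec_def inner_axis estimator)

  define L where "L \<epsilon> w = (\<Sum>i\<in>UNIV. d $ i powr (- j) *
      ((1 - \<phi>0 (W w) / (W w + \<epsilon>) / c $ i) * fst w $ i - \<theta> $ i)\<^sup>2)" for \<epsilon> w
  define L0 where "L0 w = (\<Sum>i\<in>UNIV. d $ i powr (- j) * (fst w $ i - \<theta> $ i)\<^sup>2)"
    for w :: "('p, 'n) sample"
  have [measurable]: "L \<epsilon> \<in> borel_measurable borel" "L0 \<in> borel_measurable borel" for \<epsilon>
    unfolding L_def[abs_def] L0_def[abs_def] by measurable
  have regularised: "(\<integral>\<^sup>+w. ennreal (L \<epsilon> w) \<partial>P) \<le> (\<integral>\<^sup>+w. ennreal (L0 w) \<partial>P)" if \<epsilon>: "\<epsilon> > 0" for \<epsilon>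
  proof -
    \<comment> \<open>This plays the role of \<phi>(w)/w, now bounded by
      \<open>\<kappa> / \<epsilon>\<close>, while its product with w is still at most
      \<kappa>.\<close>
    define \<psi> where "\<psi> w = \<phi>0 w / (w + \<epsilon>)" for w
    define \<psi>' where "\<psi>' w = (deriv \<phi> w * (w + \<epsilon>) - \<phi> w) / ((w + \<epsilon>) * (w + \<epsilon>))" for w
    have \<phi>0: "0 \<le> \<phi>0 w" "\<phi>0 w \<le> \<kappa>" for w
      using \<phi>[of w] \<kappa> by (auto simp: \<phi>0_def indicator_def)
    interpret finite_measure P
      unfolding P_eq using prob by (rule prob_space.finite_measure)
    interpret shrinkage_model g \<theta> l \<psi> \<psi>' \<kappa> "\<kappa> / \<epsilon>" c d "\<chi> i. d $ i powr (- j)" \<alpha>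
    proof
      show "(\<psi> has_real_derivative \<psi>' w) (at w)" if "w > 0" for w
      proof (rule has_field_derivative_transform_within_open)
        show "((\<lambda>w. \<phi> w / (w + \<epsilon>)) has_real_derivative \<psi>' w) (at w)"
          using DERIV_deriv_iff_real_differentiable[THEN iffD2, OF \<phi>_differentiable[OF that]] that \<epsilon>
          by (auto intro!: derivative_eq_intros simp: \<psi>'_def)
        show "\<phi> x / (x + \<epsilon>) = \<psi> x" if "x \<in> {0<..}" for x
          using that by (simp add: \<psi>_def \<phi>0_def)
      qed (use that in auto)
      \<comment> \<open>The sum of \<psi>'(w) w and \<psi>(w) is the derivative of w \<phi>(w)/(w +
        \<epsilon>), a product of two nonnegative nondecreasing functions.\<close>
      show "- \<psi> w \<le> \<psi>' w * w" if "w > 0" for w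
      proof -
        have "0 \<le> deriv \<phi> w * w * (w + \<epsilon>) + \<phi> w * \<epsilon>"
          using that \<epsilon> \<phi>_deriv_nonneg[OF that] \<phi>[OF that] by simp
        then have "0 \<le> (deriv \<phi> w * w * (w + \<epsilon>) + \<phi> w * \<epsilon>) / ((w + \<epsilon>) * (w + \<epsilon>))"
          using that \<epsilon> by simp
        also have "\<dots> = \<psi>' w * w + \<psi> w"
          using that \<epsilon> by (simp add: \<psi>_def \<psi>'_def \<phi>0_def divide_simps) (simp add: algebra_simps)
        finally show ?thesis by simp
      qed
      show "0 \<le> \<psi> w" if "w \<ge> 0" for w
        using that \<epsilon> \<phi>0 by (simp add: \<psi>_def)
      show "\<psi> w * w \<le> \<kappa>" if "w \<ge> 0" for w
      proof -
        have "\<phi>0 w * w \<le> \<kappa> * (w + \<epsilon>)"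
          using \<phi>0 that \<epsilon> \<kappa> by (intro mult_mono) auto
        then show ?thesis using that \<epsilon> by (simp add: \<psi>_def divide_le_eq)
      qed
      show "\<psi> w \<le> \<kappa> / \<epsilon>" if "w \<ge> 0" for w
        unfolding \<psi>_def using \<phi>0 \<kappa> that \<epsilon> by (intro frac_le) auto
      show "\<psi> 0 = 0" by (simp add: \<psi>_def \<phi>0_def)
      show "\<psi> \<in> borel_measurable borel" unfolding \<psi>_def[abs_def] by measurable
      show "integrable P (\<lambda>w. (fst w $ i)\<^sup>2)" for i
        using moments[of i] by (simp add: P_eq case_prod_unfold)
      have a_eq: "(\<chi> i. d $ i powr (- j)) $ i * d $ i / c $ i = a i" for i
        using d_pos[of i] powr_add[of "d $ i" "- j" 1] by (simp add: a_def)
      show "(\<chi> i. d $ i powr (- j)) $ i * d $ i / c $ i \<le> \<alpha>" for i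
        unfolding a_eq by (rule a_le)
      show "(real CARD('n) + 2) * \<kappa> \<le> 2 * ((\<Sum>i\<in>UNIV. (\<chi> i. d $ i powr (- j)) $ i * d $ i / c $ i) / \<alpha> - 2)"
        unfolding a_eq by (simp add: \<kappa>_def)
    qed (use l_fst l_snd c_pos d_pos two \<alpha> in auto)
    have "\<Psi> w = \<phi>0 (W w) / (W w + \<epsilon>)" for w
      by (simp add: \<Psi>_def \<psi>_def W_eq Y_def y_def S_def)
    then show ?thesis
      using expected_loss_le by (simp add: L_def L0_def)
  qed
  define e where "e m = 1 / real (Suc m)" for m
  have e_lim: "e \<longlonglongrightarrow> 0"
    unfolding e_def by (rule LIMSEQ_Suc[OF lim_1_over_n])
  \<comment> \<open>Convergence holds even at W = 0: there \<open>\<phi>0\<close> is 0, so every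
    regularised quotient vanishes and so does the limiting one.\<close>
  have L_lim: "(\<lambda>m. ennreal (L (e m) w)) \<longlonglongrightarrow> ennreal (L 0 w)" for w
  proof (rule tendsto_ennrealI)
    define R where "R r = (\<Sum>i\<in>UNIV. d $ i powr (- j) * ((1 - r / c $ i) * fst w $ i - \<theta> $ i)\<^sup>2)" for r
    have "c $ i \<noteq> 0" for i using c_pos[of i] by simp
    then have "isCont R r" for r
      unfolding R_def by (intro continuous_intros) auto
    moreover have "(\<lambda>m. \<phi>0 (W w) / (W w + e m)) \<longlonglongrightarrow> \<phi>0 (W w) / (W w + 0)"
    proof (cases "W w = 0")
      case False
      then show ?thesis by (intro tendsto_intros e_lim) simp
    qed (simp add: \<phi>0_def)
    ultimately have "(\<lambda>m. R (\<phi>0 (W w) / (W w + e m))) \<longlonglongrightarrow> R (\<phi>0 (W w) / (W w + 0))"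
      by (rule isCont_tendsto_compose)
    then show "(\<lambda>m. L (e m) w) \<longlonglongrightarrow> L 0 w"
      by (simp only: L_def R_def)
  qed
  have "(\<integral>\<^sup>+w. ennreal (L 0 w) \<partial>P) = (\<integral>\<^sup>+w. liminf (\<lambda>m. ennreal (L (e m) w)) \<partial>P)"
    by (rule nn_integral_cong) (simp add: lim_imp_Liminf[OF _ L_lim])
  also have "\<dots> \<le> liminf (\<lambda>m. \<integral>\<^sup>+w. ennreal (L (e m) w) \<partial>P)"
    by (rule nn_integral_liminf) measurable
  also have "\<dots> \<le> liminf (\<lambda>m :: nat. \<integral>\<^sup>+w. ennreal (L0 w) \<partial>P)"
    by (rule Liminf_mono) (simp add: regularised e_def)
  finally have L_le: "(\<integral>\<^sup>+w. ennreal (L 0 w) \<partial>P) \<le> (\<integral>\<^sup>+w. ennreal (L0 w) \<partial>P)"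
    by (simp add: Liminf_const)
  have scale: "ennreal (x / \<sigma>\<^sup>2) = ennreal x * ennreal (inverse (\<sigma>\<^sup>2))" for x
    by (simp add: divide_inverse flip: ennreal_mult'')
  have "risk f d j (shrinkage_estimator c d \<phi> :: ('p, 'n) sample \<Rightarrow> _) \<theta> \<sigma>
      = (\<integral>\<^sup>+w. ennreal (L 0 w) * ennreal (inverse (\<sigma>\<^sup>2)) \<partial>P)"
    unfolding risk_def P_eq loss_eq scale by (simp add: estimator L_def)
  also have "\<dots> = (\<integral>\<^sup>+w. ennreal (L 0 w) \<partial>P) * ennreal (inverse (\<sigma>\<^sup>2))"
    by (rule nn_integral_multc) measurable
  also have "\<dots> \<le> (\<integral>\<^sup>+w. ennreal (L0 w) \<partial>P) * ennreal (inverse (\<sigma>\<^sup>2))"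
    by (rule mult_right_mono[OF L_le]) simp
  also have "\<dots> = (\<integral>\<^sup>+w. ennreal (L0 w) * ennreal (inverse (\<sigma>\<^sup>2)) \<partial>P)"
    by (rule nn_integral_multc[symmetric]) measurable
  also have "\<dots> = risk f d j (fst :: ('p, 'n) sample \<Rightarrow> _) \<theta> \<sigma>"
    unfolding risk_def P_eq loss_eq scale by (simp add: L0_def)
  finally show "risk f d j (shrinkage_estimator c d \<phi> :: ('p, 'n) sample \<Rightarrow> _) \<theta> \<sigma> \<le> risk f d j (fst :: ('p, 'n) sample \<Rightarrow> _) \<theta> \<sigma>" .
qed

theorem theorem2p1:
  fixes f \<phi> :: "real \<Rightarrow> real"
    and c d :: "(real, 'p::{finite,linorder}) vec"
    and j :: real
  assumes d_decreasing: "\<And>i k. i \<le> k \<Longrightarrow> d $ k \<le> d $ i"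
    and d_pos: "\<And>i. d $ i > 0"
    and c_ge_1: "\<And>i. c $ i \<ge> 1"
    and f_nonneg: "\<And>t. t \<ge> 0 \<Longrightarrow> f t \<ge> 0"
    and f_measurable: "f \<in> borel_measurable (restrict_space borel {0..})"
    and f_density: "\<And>\<theta> \<sigma>. \<sigma> > 0 \<Longrightarrow>
      prob_space (sample_dist f d \<theta> \<sigma> :: ('p, 'n::finite) sample measure)"
    and second_moments: "\<And>\<theta> \<sigma> i. \<sigma> > 0 \<Longrightarrow>
      integrable (sample_dist f d \<theta> \<sigma> :: ('p, 'n::finite) sample measure)
        (\<lambda>(x, z). (x $ i)\<^sup>2)"
    and \<phi>_differentiable: "\<And>w. w > 0 \<Longrightarrow> \<phi> differentiable (at w)"
    and \<phi>_deriv_nonneg: "\<And>w. w > 0 \<Longrightarrow> deriv \<phi> w \<ge> 0"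
    and \<phi>_bounds: "\<And>w. w > 0 \<Longrightarrow> 0 \<le> \<phi> w \<and>
      \<phi> w \<le> 2 / (real CARD('n::finite) + 2) *
        ((\<Sum>i\<in>UNIV. d $ i powr (1 - j) / c $ i) /
          (MAX i\<in>UNIV. d $ i powr (1 - j) / c $ i) - 2)"
  shows "minimax f d j (shrinkage_estimator c d \<phi> :: ('p, 'n::finite) sample \<Rightarrow> (real, 'p) vec)"
proof -
  have c_pos: "c $ i > 0" for i using c_ge_1[of i] by simp
  note compare = risk_shrinkage_le_risk_identity[OF d_pos c_pos _ f_measurable f_density
      second_moments \<phi>_differentiable \<phi>_deriv_nonneg \<phi>_bounds]
  show ?thesis
    unfolding minimax_def
  proof (intro conjI allI impI)
    show "(shrinkage_estimator c d \<phi> :: ('p, 'n) sample \<Rightarrow> _) \<in> borel_measurable borel"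
      using compare(2)[of 1] by simp
    fix \<delta>' :: "('p, 'n) sample \<Rightarrow> (real, 'p) vec"
    assume \<delta>': "\<delta>' \<in> borel_measurable borel"
    show "max_risk f d j (shrinkage_estimator c d \<phi> :: ('p, 'n) sample \<Rightarrow> _) \<le> max_risk f d j \<delta>'"
      unfolding max_risk_def[of f d j "shrinkage_estimator c d \<phi>"]
    proof (rule SUP_least)
      fix q :: "(real, 'p) vec \<times> real"
      assume "q \<in> UNIV \<times> {0<..}"
      then obtain \<theta> \<sigma> where q: "q = (\<theta>, \<sigma>)" and "\<sigma> > 0" by auto
      have "risk f d j (shrinkage_estimator c d \<phi> :: ('p, 'n) sample \<Rightarrow> _) \<theta> \<sigma> \<le> risk f d j (fst :: ('p, 'n) sample \<Rightarrow> _) \<theta> \<sigma>"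
        by (rule compare(1)) (use \<open>\<sigma> > 0\<close> in auto)
      also have "\<dots> \<le> max_risk f d j \<delta>'"
        by (rule risk_identity_le_max_risk[OF d_pos f_measurable \<delta>' \<open>\<sigma> > 0\<close>])
      finally show "(case q of (\<theta>, \<sigma>) \<Rightarrow>
          risk f d j (shrinkage_estimator c d \<phi> :: ('p, 'n) sample \<Rightarrow> _) \<theta> \<sigma>) \<le> max_risk f d j \<delta>'"
        by (simp add: q)
    qed
  qed
qed

end
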